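(* Let $(A,B)\in\mathbf{G}^2$ and suppose that there exists $T\in\mathrm{GL}(2,\mathbb{R})$ such that both $T^{-1}AT$ and $T^{-1}BT$ are non-negative. Then $(A,B)$ is a balanced pair if and only if there exists $t>0$ such that $(A,tB)$ is a finiteness counter-example.
   Context: **Matrices and balanced pairs.** Let $\mathbf{G}=\{X\in \mathrm{GL}(2,\mathbb{R}):\det X>0\}$, let $I$ be the identity matrix, $\mathbf{A}=\{A\in\mathrm{SL}(2,\mathbb{R}):\operatorname{tr}A\ge 2\}\setminus\{I\}$, $\mathbf{H}=\{A\in\mathbf{A}:\operatorname{tr}A>2\}$, $\mathbf{P}=\{A\in\mathbf{A}:\operatorname{tr}A=2\}$. For $\lambda>1$ and $u<0<s$ let $$H_{s,u}^\lambda=\begin{pmatrix} s&u\\ 1&1\end{pmatrix}\begin{pmatrix}\lambda&0\\ 0&\lambda^{-1}\end{pmatrix}\begin{pmatrix} s&u\\ 1&1\end{pmatrix}^{-1}\in\mathbf{H},$$ and for $x>0$ let $P_x=\begin{pmatrix}1&0\\ x&1\end{pmatrix}\in\mathbf{P}$. $A^t$ denotes the transpose of $A$. A matrix in $\mathbf{G}$ is non-negative if all its entries are $\ge 0$. A set $\{A,B\}\subset\mathbf{A}$ is called a balanced pair if there is $T\in\mathrm{GL}(2,\mathbb{R})$ such that $\{T^{-1}AT,T^{-1}BT\}$ is of one of the following (mutually exclusive) forms: (h) $\{H_{s_1,u_1}^{\lambda_1},H_{s_2,u_2}^{\lambda_2}\}$ with $u_2<u_1<0<s_1<s_2$; (m)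 $\{H_{s,u}^\lambda,P_x\}$; (p) $\{P_x,P_y^t\}$ (with parameters in the ranges above). A set $\{A,B\}\subset\mathbf{G}$ is called a balanced pair if $\{aA,bB\}\subset\mathbf{A}$ is a balanced pair for some $a,b\in\mathbb{R}$. An ordered pair $(A,B)\in\mathbf{G}^2$ is called a balanced pair if $\{A,B\}$ is. **Finiteness counter-examples.** Let $\rho(X)$ denote the spectral radius of $X$. For $\mathbb{A}=(A,B)\in\mathbf{G}^2$ the joint spectral radius is $$\hat\rho(\mathbb{A})=\limsup_{n\to\infty}\left(\max\{\rho(X_1\cdots X_n):X_1,\dots,X_n\in\{A,B\}\}\right)^{1/n}.$$ A finite product $X_1\cdots X_n$ ($n\ge1$, $X_i\in\{A,B\}$) is a spectrum maximizing product of $\mathbb{A}$ if $\rho(X_1\cdots X_n)^{1/n}=\hat\rho(\mathbb{A})$. The pair $\mathbb{A}$ is called a finiteness counter-example if it admits no spectrum maximizing product. *)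

theory Defs
  imports "HOL-Analysis.Analysis"
begin

type_synonym mat2 = "real ^ 2 ^ 2"

definition mat2_of :: "real \<Rightarrow> real \<Rightarrow> real \<Rightarrow> real \<Rightarrow> mat2" where
  "mat2_of a b c d = vector [vector [a, b], vector [c, d]]"

definition GL_pos :: "mat2 set" where
  "GL_pos = {X. invertible X \<and> det X > 0}"

definition nonneg_mat :: "mat2 \<Rightarrow> bool" where
  "nonneg_mat X \<longleftrightarrow> (\<forall>i j. X $ i $ j \<ge> 0)"

definition conjugate :: "mat2 \<Rightarrow> mat2 \<Rightarrow> mat2" where
  "conjugate T X = matrix_inv T ** X ** T"

definition SL_A :: "mat2 set" where
  "SL_A = {X. det X = 1 \<and> trace X \<ge> 2} - {mat 1}"

definition H_mat :: "real \<Rightarrow> real \<Rightarrow> real \<Rightarrow> mat2" where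
  "H_mat l s u =
     mat2_of s u 1 1 ** mat2_of l 0 0 (inverse l) ** matrix_inv (mat2_of s u 1 1)"

definition P_mat :: "real \<Rightarrow> mat2" where
  "P_mat x = mat2_of 1 0 x 1"

definition form_h :: "mat2 set \<Rightarrow> bool" where
  "form_h S \<longleftrightarrow> (\<exists>l1 l2 s1 s2 u1 u2. l1 > 1 \<and> l2 > 1 \<and>
     u2 < u1 \<and> u1 < 0 \<and> 0 < s1 \<and> s1 < s2 \<and> S = {H_mat l1 s1 u1, H_mat l2 s2 u2})"

definition form_m :: "mat2 set \<Rightarrow> bool" where
  "form_m S \<longleftrightarrow> (\<exists>l s u x. l > 1 \<and> u < 0 \<and> 0 < s \<and> x > 0 \<and> S = {H_mat l s u, P_mat x})"

definition form_p :: "mat2 set \<Rightarrow> bool" where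
  "form_p S \<longleftrightarrow> (\<exists>x y. x > 0 \<and> y > 0 \<and> S = {P_mat x, transpose (P_mat y)})"

definition balanced_pair_SL :: "mat2 \<Rightarrow> mat2 \<Rightarrow> bool" where
  "balanced_pair_SL A B \<longleftrightarrow> {A, B} \<subseteq> SL_A \<and>
     (\<exists>T. invertible T \<and>
       (let S = {conjugate T A, conjugate T B} in form_h S \<or> form_m S \<or> form_p S))"

definition balanced_pair :: "mat2 \<Rightarrow> mat2 \<Rightarrow> bool" where
  "balanced_pair A B \<longleftrightarrow> {A, B} \<subseteq> GL_pos \<and>
     (\<exists>a b :: real. balanced_pair_SL (a *\<^sub>R A) (b *\<^sub>R B))"

(* Eigenvalues are complex: they are those of the complexified matrix. *)
definition complex_eigenvalues :: "mat2 \<Rightarrow> complex set" where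
  "complex_eigenvalues X =
     {z. \<exists>v :: complex ^ 2. v \<noteq> 0 \<and> (\<chi> i j. complex_of_real (X $ i $ j)) *v v = z *s v}"

definition spectral_radius :: "mat2 \<Rightarrow> real" where
  "spectral_radius X = Max (cmod ` complex_eigenvalues X)"

definition mat_prod :: "mat2 list \<Rightarrow> mat2" where
  "mat_prod Xs = foldr (**) Xs (mat 1)"

definition words :: "mat2 \<Rightarrow> mat2 \<Rightarrow> nat \<Rightarrow> mat2 list set" where
  "words A B n = {Xs. length Xs = n \<and> set Xs \<subseteq> {A, B}}"

(* Valued in ereal so that the limsup is taken in a complete lattice.
   The junk term at n = 0 (where root 0 = 0) does not affect it. *)
definition joint_spectral_radius :: "mat2 \<Rightarrow> mat2 \<Rightarrow> ereal" where
  "joint_spectral_radius A B =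
     limsup (\<lambda>n. ereal (root n (Max ((\<lambda>Xs. spectral_radius (mat_prod Xs)) ` words A B n))))"

definition spectrum_maximizing :: "mat2 \<Rightarrow> mat2 \<Rightarrow> mat2 list \<Rightarrow> bool" where
  "spectrum_maximizing A B Xs \<longleftrightarrow> (\<exists>n\<ge>1. Xs \<in> words A B n \<and>
     ereal (root n (spectral_radius (mat_prod Xs))) = joint_spectral_radius A B)"

definition finiteness_counterexample :: "mat2 \<Rightarrow> mat2 \<Rightarrow> bool" where
  "finiteness_counterexample A B \<longleftrightarrow>
     {A, B} \<subseteq> GL_pos \<and> \<not> (\<exists>Xs. spectrum_maximizing A B Xs)"

end

(* Conjugate the pair to non-negative matrices. Balanced then means that det (AB - BA) < 0, i.e. that the
   axes of A and B are disjoint (or absent, in the parabolic case) and nested. If det (AB - BA) >= 0, the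
   pair is simultaneously symmetrizable or triangularizable, so the spectral radius of a word is at most
   the product of the spectral radii of its letters, and a single letter is spectrum maximizing.

   If det (AB - BA) < 0, rescale so that the joint spectral radius is 1. Two words of spectral radius 1
   have the same frequency of B: conjugating so that A and B have equal diagonal entries, an exchange
   argument on the pairs (attracting, repelling fixed point) of the rotations shows that such words
   cannot contain both AA and BB cyclically, so they are words in A and AB (or in B and BA), again a
   pair with negative commutator determinant, and one descends. Were some word maximizing for (A, tB) for
   each t > 0, the sets of log t where a given word is maximizing would be closed, pairwise equal or
   disjoint, and countably many; by Sierpinski's theorem one word would be maximizing on a long interval,
   which is impossible since small t favours A and large t favours B. *)

theory Submission
  imports Defs
begin

subsection \<open>Two by two matrices\<close>

text \<open>One sign survives every operation used: \<open>det (A ** B - B ** A)\<close> is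
  invariant under conjugation, gains a positive factor when letters are rescaled, and is multiplied
  by \<open>det A\<close> when \<open>B\<close> is replaced by \<open>A ** B\<close>. Equality of
  the diagonal entries does not survive this replacement, so the pair has to be renormalized at each
  level of the descent. That equality is wanted because reversing a word then acts on its product as
  an anti-automorphism exchanging the left and right fixed vectors. Spectral radius 1 is encoded by
  trace and determinant, through the characteristic polynomial at 1. Comparing words thus becomes a
  matter of polynomial identities, and for a product of two words the polynomial factors into
  differences of fixed points. Frequencies matter because the growth of a word is affine in
  \<open>ln t\<close>, its slope being the frequency of \<open>B\<close>. Two words that are
  maximizing for one \<open>t\<close> and have the same slope define the same affine function, hence
  are maximizing for the same values of \<open>t\<close>. No explicit exceptional \<open>t\<close>
  is produced; it comes out of a covering argument.\<close>

lemma mult_2x2 [simp]: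
  fixes X Y :: mat2
  shows "(X ** Y) $ i $ j = X $ i $ 1 * Y $ 1 $ j + X $ i $ 2 * Y $ 2 $ j"
  by (simp add: matrix_matrix_mult_def sum_2)

lemma mat_1_2x2 [simp]:
  "(mat 1 :: mat2) $ 1 $ 1 = 1" "(mat 1 :: mat2) $ 1 $ 2 = 0"
  "(mat 1 :: mat2) $ 2 $ 1 = 0" "(mat 1 :: mat2) $ 2 $ 2 = 1"
  by (simp_all add: mat_def)

lemma mat2_of_nth [simp]:
  "mat2_of a b c d $ 1 $ 1 = a" "mat2_of a b c d $ 1 $ 2 = b"
  "mat2_of a b c d $ 2 $ 1 = c" "mat2_of a b c d $ 2 $ 2 = d"
  by (simp_all add: mat2_of_def)

lemma trace_2x2: "trace (X :: mat2) = X $ 1 $ 1 + X $ 2 $ 2"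
  by (simp add: trace_def sum_2)

lemma mat2_eq_iff:
  "(X :: mat2) = Y \<longleftrightarrow> X $ 1 $ 1 = Y $ 1 $ 1 \<and> X $ 1 $ 2 = Y $ 1 $ 2
     \<and> X $ 2 $ 1 = Y $ 2 $ 1 \<and> X $ 2 $ 2 = Y $ 2 $ 2"
  by (simp add: vec_eq_iff forall_2)

lemma invertible_2x2_iff: "invertible (X :: mat2) \<longleftrightarrow> X $ 1 $ 1 * X $ 2 $ 2 - X $ 1 $ 2 * X $ 2 $ 1 \<noteq> 0"
  by (simp add: invertible_det_nz det_2)

lemma matrix_inv_left: "invertible (T :: mat2) \<Longrightarrow> matrix_inv T ** T = mat 1"
  and matrix_inv_right: "invertible (T :: mat2) \<Longrightarrow> T ** matrix_inv T = mat 1"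
  unfolding matrix_inv_def invertible_def by (metis (mono_tags, lifting) someI_ex)+

lemma matrix_inv_eqI:
  fixes X Y :: mat2
  assumes "X ** Y = mat 1"
  shows "matrix_inv X = Y"
  using assms by (metis invertible_def matrix_inv_left matrix_left_right_inverse
      matrix_mul_assoc matrix_mul_lid matrix_mul_rid)

lemma conjugate_eqI:
  assumes "invertible T" "X ** T = T ** Y"
  shows "conjugate T X = Y"
  using assms by (metis conjugate_def matrix_inv_left matrix_mul_assoc matrix_mul_lid)

lemma mult_conjugate: "invertible T \<Longrightarrow> T ** conjugate T X = X ** T"
  by (metis conjugate_def matrix_inv_right matrix_mul_assoc matrix_mul_lid)

lemma trace_conjugate: "invertible T \<Longrightarrow> trace (conjugate T X) = trace X"
  by (metis conjugate_def matrix_inv_right matrix_mul_assoc matrix_mul_rid trace_mul_sym)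

lemma det_conjugate: "invertible T \<Longrightarrow> det (conjugate T X) = det X"
  by (metis conjugate_def det_mul matrix_inv_right matrix_mul_assoc matrix_mul_lid mult.commute)

lemma conjugate_mult:
  assumes "invertible T"
  shows "conjugate T (X ** Y) = conjugate T X ** conjugate T Y"
  using assms by (intro conjugate_eqI) (simp, metis matrix_mul_assoc mult_conjugate)

lemma conjugate_diff:
  assumes "invertible T"
  shows "conjugate T (X - Y) = conjugate T X - conjugate T Y"
  unfolding conjugate_def by (simp add: mat2_eq_iff algebra_simps)

lemma conjugate_scaleR: "conjugate T (c *\<^sub>R X) = c *\<^sub>R conjugate T X"
  unfolding conjugate_def by (simp add: mat2_eq_iff algebra_simps)

lemma conjugate_mat_1: "invertible T \<Longrightarrow> conjugate T (mat 1) = mat 1"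
  by (intro conjugate_eqI) simp_all

lemma conjugate_conjugate:
  assumes "invertible S" "invertible T"
  shows "conjugate T (conjugate S X) = conjugate (S ** T) X"
  using assms by (intro conjugate_eqI[symmetric])
    (simp add: invertible_mult, metis matrix_mul_assoc mult_conjugate)

lemma det_scaleR_2x2: "det (c *\<^sub>R X :: mat2) = c\<^sup>2 * det X"
  by (simp add: det_2 power2_eq_square algebra_simps)

lemma trace_scaleR_2x2: "trace (c *\<^sub>R X :: mat2) = c * trace X"
  by (simp add: trace_2x2 algebra_simps)

definition pos_mat :: "mat2 \<Rightarrow> bool" where
  "pos_mat X \<longleftrightarrow> nonneg_mat X \<and> det X > 0"

lemma nonneg_mat_iff: "nonneg_mat X \<longleftrightarrow> X $ 1 $ 1 \<ge> 0 \<and> X $ 1 $ 2 \<ge> 0 \<and> X $ 2 $ 1 \<ge> 0 \<and> X $ 2 $ 2 \<ge> 0"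
  by (auto simp: nonneg_mat_def forall_2)

lemma pos_mat_iff:
  "pos_mat X \<longleftrightarrow> X $ 1 $ 1 > 0 \<and> X $ 1 $ 2 \<ge> 0 \<and> X $ 2 $ 1 \<ge> 0 \<and> X $ 2 $ 2 > 0
     \<and> X $ 1 $ 1 * X $ 2 $ 2 > X $ 1 $ 2 * X $ 2 $ 1"
proof -
  have "X $ 1 $ 1 \<noteq> 0 \<and> X $ 2 $ 2 \<noteq> 0" if "nonneg_mat X" "det X > 0"
  proof -
    have "X $ 1 $ 2 * X $ 2 $ 1 \<ge> 0" using that by (simp add: nonneg_mat_iff)
    then have "X $ 1 $ 1 * X $ 2 $ 2 > 0" using that by (simp add: det_2)
    then show ?thesis by auto
  qed
  then show ?thesis
    unfolding pos_mat_def by (auto simp: nonneg_mat_iff det_2 order_less_le)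
qed

lemma pos_mat_mult: "pos_mat X \<Longrightarrow> pos_mat Y \<Longrightarrow> pos_mat (X ** Y)"
  by (auto simp: pos_mat_def nonneg_mat_iff det_mul)

lemma pos_mat_1: "pos_mat (mat 1)"
  by (simp add: pos_mat_iff)

lemma pos_mat_scaleR: "c > 0 \<Longrightarrow> pos_mat X \<Longrightarrow> pos_mat (c *\<^sub>R X)"
  by (auto simp: pos_mat_def nonneg_mat_iff det_scaleR_2x2)

lemma pos_mat_trace_pos: "pos_mat X \<Longrightarrow> trace X > 0"
  by (auto simp: pos_mat_iff trace_2x2)

lemma pos_mat_disc: "pos_mat X \<Longrightarrow> (trace X)\<^sup>2 \<ge> 4 * det X"
proof -
  assume "pos_mat X"
  then have "X $ 1 $ 2 * X $ 2 $ 1 \<ge> 0" by (simp add: pos_mat_iff)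
  moreover have "(trace X)\<^sup>2 - 4 * det X = (X $ 1 $ 1 - X $ 2 $ 2)\<^sup>2 + 4 * (X $ 1 $ 2 * X $ 2 $ 1)"
    by (simp add: trace_2x2 det_2 power2_eq_square algebra_simps)
  moreover have "(X $ 1 $ 1 - X $ 2 $ 2)\<^sup>2 \<ge> 0" by simp
  ultimately show ?thesis by linarith
qed

subsection \<open>Spectral radius\<close>

definition perron :: "mat2 \<Rightarrow> real" where
  "perron X = (trace X + sqrt ((trace X)\<^sup>2 - 4 * det X)) / 2"

text \<open>Both eigenvalues are real and positive. Unlike \<open>pos_mat\<close>, the condition
  depends on trace and determinant only, so it passes to every conjugate.\<close>

definition real_spectrum :: "mat2 \<Rightarrow> bool" where
  "real_spectrum X \<longleftrightarrow> trace X > 0 \<and> det X > 0 \<and> (trace X)\<^sup>2 \<ge> 4 * det X"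

lemma pos_mat_real_spectrum: "pos_mat X \<Longrightarrow> real_spectrum X"
  by (simp add: real_spectrum_def pos_mat_trace_pos pos_mat_disc) (simp add: pos_mat_def)

lemma complex_eigenvalues_eq:
  "complex_eigenvalues X = {z. z\<^sup>2 - of_real (trace X) * z + of_real (det X) = 0}"
proof -
  have "(\<exists>v :: complex ^ 2. v \<noteq> 0 \<and> (\<chi> i j. complex_of_real (X $ i $ j)) *v v = z *s v)
     \<longleftrightarrow> z\<^sup>2 - of_real (trace X) * z + of_real (det X) = 0" (is "?L \<longleftrightarrow> ?R") for z
  proof -
    define M :: "complex^2^2" where "M = (\<chi> i j. complex_of_real (X $ i $ j)) - mat z"
    have "?L \<longleftrightarrow> (\<exists>v. v \<noteq> 0 \<and> M *v v = 0)"
      by (simp add: M_def vec_eq_iff forall_2 matrix_vector_mult_def sum_2 mat_def algebra_simps)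
    also have "\<dots> \<longleftrightarrow> \<not> invertible M"
      by (metis invertible_left_inverse matrix_left_invertible_ker)
    also have "\<dots> \<longleftrightarrow> det M = 0" by (simp add: invertible_det_nz)
    also have "det M = z\<^sup>2 - of_real (trace X) * z + of_real (det X)"
      by (simp add: M_def det_2 mat_def trace_2x2 power2_eq_square algebra_simps)
    finally show ?thesis .
  qed
  then show ?thesis unfolding complex_eigenvalues_def by blast
qed

lemma spectral_radius_eq_perron:
  assumes "real_spectrum X"
  shows "spectral_radius X = perron X"
proof -
  define q where "q = sqrt ((trace X)\<^sup>2 - 4 * det X)"
  define m where "m = (trace X - q) / 2"
  have q2: "q\<^sup>2 = (trace X)\<^sup>2 - 4 * det X" and q0: "q \<ge> 0"
    using assms by (simp_all add: q_def real_spectrum_def)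
  have "q\<^sup>2 < (trace X)\<^sup>2" using q2 assms by (simp add: real_spectrum_def)
  then have qt: "q < trace X" using assms by (meson less_imp_le power2_less_imp_less real_spectrum_def)
  have p: "perron X = (trace X + q) / 2" by (simp add: perron_def q_def)
  have sum: "perron X + m = trace X" by (simp add: p m_def field_simps)
  have "perron X * m = ((trace X)\<^sup>2 - q\<^sup>2) / 4" by (simp add: p m_def power2_eq_square algebra_simps)
  then have prd: "perron X * m = det X" using q2 by simp
  have "z\<^sup>2 - of_real (trace X) * z + of_real (det X) = (z - of_real (perron X)) * (z - of_real m)"
    for z :: complex
    unfolding sum[symmetric] prd[symmetric] by (simp add: power2_eq_square algebra_simps)
  then have "complex_eigenvalues X = {of_real (perron X), of_real m}"
    unfolding complex_eigenvalues_eq by auto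
  then have "spectral_radius X = max \<bar>perron X\<bar> \<bar>m\<bar>"
    by (simp add: spectral_radius_def)
  also have "\<dots> = perron X" using q0 qt by (simp add: p m_def)
  finally show ?thesis .
qed


lemma perron_facts:
  assumes "real_spectrum X"
  shows perron_pos: "perron X > 0"
    and perron_char: "det X = perron X * (trace X - perron X)"
    and perron_ge: "perron X \<ge> trace X - perron X"
    and perron_co_pos: "trace X - perron X > 0"
proof -
  define q where "q = sqrt ((trace X)\<^sup>2 - 4 * det X)"
  have q2: "q\<^sup>2 = (trace X)\<^sup>2 - 4 * det X" and q0: "q \<ge> 0"
    using assms by (simp_all add: q_def real_spectrum_def)
  have p: "perron X = (trace X + q) / 2" by (simp add: perron_def q_def)
  show "perron X > 0" using assms q0 by (simp add: p real_spectrum_def)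
  show c: "det X = perron X * (trace X - perron X)"
    using q2 unfolding p by (simp add: power2_eq_square field_simps)
  show "perron X \<ge> trace X - perron X" using q0 by (simp add: p field_simps)
  show "trace X - perron X > 0" using c assms \<open>perron X > 0\<close>
    by (metis real_spectrum_def zero_less_mult_pos)
qed

lemma perron_eqI:
  assumes "trace X = l + m" "det X = l * m" "l \<ge> m"
  shows "perron X = l"
proof -
  have "(trace X)\<^sup>2 - 4 * det X = (l - m)\<^sup>2"
    by (simp add: assms power2_eq_square algebra_simps)
  then show ?thesis using assms by (simp add: perron_def)
qed

lemma perron_conjugate: "invertible T \<Longrightarrow> perron (conjugate T X) = perron X"
  by (simp add: perron_def trace_conjugate det_conjugate)

lemma perron_scaleR:
  assumes "c > 0" "real_spectrum X"
  shows "perron (c *\<^sub>R X) = c * perron X"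
proof (rule perron_eqI)
  show "trace (c *\<^sub>R X) = c * perron X + c * (trace X - perron X)"
    by (simp add: trace_scaleR_2x2 algebra_simps)
  show "det (c *\<^sub>R X) = c * perron X * (c * (trace X - perron X))"
    using perron_char[OF assms(2)] by (simp add: det_scaleR_2x2 power2_eq_square)
  show "c * perron X \<ge> c * (trace X - perron X)"
    using assms perron_ge by simp
qed

text \<open>\<open>1 + det X - trace X\<close> is the characteristic polynomial at 1, that is
  \<open>(1 - l) * (1 - m)\<close> for the eigenvalues \<open>l\<close> and \<open>m\<close>. Its
  sign cannot tell two eigenvalues below 1 from two above 1; the bound on the determinant
  does.\<close>

lemma perron_le_1_iff:
  assumes "real_spectrum X"
  shows "perron X \<le> 1 \<longleftrightarrow> det X \<le> 1 \<and> trace X \<le> 1 + det X"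
    and "perron X = 1 \<longleftrightarrow> det X \<le> 1 \<and> trace X = 1 + det X"
proof -
  define l m where "l = perron X" and "m = trace X - perron X"
  have t: "trace X = l + m" "det X = l * m" "l \<ge> m" "l > 0" "m > 0"
    using perron_facts[OF assms] by (simp_all add: l_def m_def)
  have e: "1 + det X - trace X = (1 - l) * (1 - m)" by (simp add: t algebra_simps)
  have "l \<le> 1 \<longleftrightarrow> l * m \<le> 1 \<and> 0 \<le> (1 - l) * (1 - m)"
  proof
    assume "l \<le> 1"
    moreover have "l * m \<le> 1 * 1" using \<open>l \<le> 1\<close> t by (intro mult_mono) auto
    ultimately show "l * m \<le> 1 \<and> 0 \<le> (1 - l) * (1 - m)" using t by simp
  next
    assume a: "l * m \<le> 1 \<and> 0 \<le> (1 - l) * (1 - m)"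
    show "l \<le> 1"
    proof (rule ccontr)
      assume "\<not> l \<le> 1"
      then have "m \<ge> 1" using a by (simp add: zero_le_mult_iff)
      then have "l * m > 1" using \<open>\<not> l \<le> 1\<close> by (metis less_1_mult linorder_not_le mult.right_neutral order_le_less)
      then show False using a by simp
    qed
  qed
  then show "perron X \<le> 1 \<longleftrightarrow> det X \<le> 1 \<and> trace X \<le> 1 + det X"
    unfolding e[symmetric] l_def[symmetric] t(2) by auto
  have "l = 1 \<longleftrightarrow> l * m \<le> 1 \<and> (1 - l) * (1 - m) = 0"
  proof
    assume a: "l * m \<le> 1 \<and> (1 - l) * (1 - m) = 0"
    then consider "l = 1" | "m = 1" by auto
    then show "l = 1" using a t by cases auto
  qed (use t in auto)
  then show "perron X = 1 \<longleftrightarrow> det X \<le> 1 \<and> trace X = 1 + det X"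
    unfolding e[symmetric] l_def[symmetric] t(2) by auto 
qed

subsection \<open>Words and growth rates\<close>

fun wprod :: "mat2 \<Rightarrow> mat2 \<Rightarrow> bool list \<Rightarrow> mat2" where
  "wprod A B [] = mat 1"
| "wprod A B (x # w) = (if x then B else A) ** wprod A B w"

abbreviation nB :: "bool list \<Rightarrow> nat" where
  "nB w \<equiv> length (filter (\<lambda>x. x) w)"

lemma wprod_append: "wprod A B (v @ w) = wprod A B v ** wprod A B w"
  by (induction v) (auto simp: matrix_mul_assoc)

lemma wprod_pos: "pos_mat A \<Longrightarrow> pos_mat B \<Longrightarrow> pos_mat (wprod A B w)"
  by (induction w) (auto simp: pos_mat_1 pos_mat_mult)

lemma wprod_conjugate:
  "invertible T \<Longrightarrow> wprod (conjugate T A) (conjugate T B) w = conjugate T (wprod A B w)"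
  by (induction w) (auto simp: conjugate_mat_1 conjugate_mult)

lemma wprod_scaleR:
  "wprod (a *\<^sub>R A) (b *\<^sub>R B) w = (a ^ (length w - nB w) * b ^ nB w) *\<^sub>R wprod A B w"
proof (induction w)
  case (Cons x w)
  then show ?case
    by (auto simp: mat2_eq_iff algebra_simps Suc_diff_le)
qed simp

lemma wprod_real_spectrum: "pos_mat A \<Longrightarrow> pos_mat B \<Longrightarrow> real_spectrum (wprod A B w)"
  by (intro pos_mat_real_spectrum wprod_pos)

definition growth :: "mat2 \<Rightarrow> mat2 \<Rightarrow> bool list \<Rightarrow> real" where
  "growth A B w = ln (perron (wprod A B w)) / length w"

definition max_word :: "mat2 \<Rightarrow> mat2 \<Rightarrow> bool list \<Rightarrow> bool" where
  "max_word A B w \<longleftrightarrow> w \<noteq> [] \<and> (\<forall>v. v \<noteq> [] \<longrightarrow> growth A B v \<le> growth A B w)"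

lemma root_perron:
  assumes "pos_mat A" "pos_mat B" "w \<noteq> []"
  shows "root (length w) (perron (wprod A B w)) = exp (growth A B w)"
proof -
  have "perron (wprod A B w) > 0"
    by (intro perron_pos wprod_real_spectrum assms)
  then show ?thesis using assms(3)
    by (simp add: growth_def root_powr_inverse powr_def)
qed

text \<open>\<open>f\<close> stands for the powers of \<open>X\<close>. By Cayley-Hamilton their
  traces satisfy a linear recurrence of order two, solved by the power sums of the
  eigenvalues.\<close>

lemma trace_det_power:
  fixes f :: "nat \<Rightarrow> mat2"
  assumes f: "f 0 = mat 1" "\<And>k. f (Suc k) = X ** f k"
    and X: "trace X = l + m" "det X = l * m"
  shows "trace (f k) = l ^ k + m ^ k" "det (f k) = (l * m) ^ k"
proof -
  have s2: "trace (X ** (X ** M)) = trace X * trace (X ** M) - det X * trace M" for M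
    by (simp add: trace_2x2 det_2 algebra_simps)
  show "trace (f k) = l ^ k + m ^ k"
  proof (induction k rule: induct_nat_012)
    case 0
    then show ?case by (simp add: f trace_2x2)
  next
    case 1
    then show ?case by (simp add: f X)
  next
    case (ge2 k)
    have "trace (f (Suc (Suc k))) = (l + m) * (l ^ Suc k + m ^ Suc k) - (l * m) * (l ^ k + m ^ k)"
      using ge2 s2[of "f k"] by (simp add: f X)
    then show ?case by (simp add: algebra_simps)
  qed
  show "det (f k) = (l * m) ^ k"
    by (induction k) (auto simp: f det_mul X)
qed

lemma growth_replicate:
  assumes "pos_mat A" "pos_mat B" "w \<noteq> []" "k > 0"
  shows "growth A B (concat (replicate k w)) = growth A B w"
proof -
  define X where "X = wprod A B w"
  define f where "f k = wprod A B (concat (replicate k w))" for k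
  define l m where "l = perron X" and "m = trace X - perron X"
  have X: "real_spectrum X" unfolding X_def by (intro wprod_real_spectrum assms)
  have lm: "trace X = l + m" "det X = l * m" "l \<ge> m" "m > 0" "l > 0"
    using perron_facts[OF X] by (simp_all add: l_def m_def)
  have f0: "f 0 = mat 1" "\<And>k. f (Suc k) = X ** f k"
    by (simp_all add: f_def wprod_append X_def)
  have "perron (f k) = l ^ k"
  proof (rule perron_eqI)
    show "trace (f k) = l ^ k + m ^ k" "det (f k) = l ^ k * m ^ k"
      using trace_det_power[OF f0 lm(1,2), of k] by (simp_all add: power_mult_distrib)
    show "l ^ k \<ge> m ^ k" using lm by (intro power_mono) auto
  qed
  moreover have "length (concat (replicate k w)) = k * length w"
    by (induction k) auto
  ultimately show ?thesis using assms lm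
    by (simp add: growth_def f_def[symmetric] X_def[symmetric] l_def[symmetric] ln_realpow)
qed

lemma words_eq: "words A B n = map (\<lambda>x. if x then B else A) ` {w. length w = n}"
proof -
  have "Xs \<in> map (\<lambda>x. if x then B else A) ` {w. length w = n}"
    if "length Xs = n" "set Xs \<subseteq> {A, B}" for Xs
  proof (rule image_eqI)
    \<comment> \<open>If \<open>A = B\<close>, the coding by Booleans is not injective; the test
      \<open>X = B\<close> still picks a preimage.\<close>
    show "Xs = map (\<lambda>x. if x then B else A) (map (\<lambda>X. X = B) Xs)"
      using that(2) by (induction Xs) auto
  qed (use that in auto)
  then show ?thesis unfolding words_def by auto
qed

lemma mat_prod_map: "mat_prod (map (\<lambda>x. if x then B else A) w) = wprod A B w"
  by (induction w) (auto simp: mat_prod_def)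

lemma finite_bool_lists: "finite {w :: bool list. length w = n}"
  using finite_lists_length_eq[of "UNIV :: bool set" n] by simp

lemma finite_bool_lists_le: "finite {w :: bool list. length w \<le> n}"
  using finite_lists_length_le[of "UNIV :: bool set" n] by simp

section \<open>The joint spectral radius as a supremum over words\<close>

context
  fixes A B T :: mat2
  assumes T: "invertible T" and pos: "pos_mat (conjugate T A)" "pos_mat (conjugate T B)"
begin

private abbreviation "g \<equiv> growth (conjugate T A) (conjugate T B)"

lemma spectral_radius_wprod:
  "spectral_radius (wprod A B w) = perron (wprod (conjugate T A) (conjugate T B) w)"
proof -
  have "real_spectrum (wprod (conjugate T A) (conjugate T B) w)"
    by (intro wprod_real_spectrum pos)
  then have "real_spectrum (wprod A B w)"
    by (simp add: wprod_conjugate T real_spectrum_def trace_conjugate det_conjugate)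
  then show ?thesis
    by (simp add: spectral_radius_eq_perron wprod_conjugate T perron_conjugate)
qed

lemma root_Max_words:
  assumes "n \<ge> 1"
  shows "\<exists>w. length w = n \<and> root n (Max ((\<lambda>Xs. spectral_radius (mat_prod Xs)) ` words A B n)) = exp (g w)"
    and "length w = n \<Longrightarrow> exp (g w) \<le> root n (Max ((\<lambda>Xs. spectral_radius (mat_prod Xs)) ` words A B n))"
proof -
  define R where "R = (\<lambda>w. perron (wprod (conjugate T A) (conjugate T B) w)) ` {w. length w = n}"
  have eq: "(\<lambda>Xs. spectral_radius (mat_prod Xs)) ` words A B n = R"
    unfolding words_eq R_def by (simp add: image_image mat_prod_map spectral_radius_wprod)
  have fin: "finite R" unfolding R_def using finite_bool_lists by auto
  have "replicate n True \<in> {w. length w = n}" by simp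
  then have ne: "R \<noteq> {}" unfolding R_def by blast
  from Max_in[OF fin ne] obtain u where w: "length u = n"
    "Max R = perron (wprod (conjugate T A) (conjugate T B) u)"
    unfolding R_def by auto
  have "root n (Max R) = exp (g u)"
    using w assms root_perron[OF pos, of u] by (cases u) auto
  with w(1) show "\<exists>w. length w = n \<and> root n (Max ((\<lambda>Xs. spectral_radius (mat_prod Xs)) ` words A B n)) = exp (g w)"
    unfolding eq by blast
  assume "length w = n"
  then have "perron (wprod (conjugate T A) (conjugate T B) w) \<le> Max R"
    using fin by (intro Max_ge) (auto simp: R_def)
  then have "root n (perron (wprod (conjugate T A) (conjugate T B) w)) \<le> root n (Max R)"
    using assms by simp
  then show "exp (g w) \<le> root n (Max ((\<lambda>Xs. spectral_radius (mat_prod Xs)) ` words A B n))"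
    unfolding eq using root_perron[OF pos, of w] \<open>length w = n\<close> assms by fastforce
qed

text \<open>The powers of a word all have its growth, so every value recurs at arbitrarily large
  lengths, and the limit superior is already the supremum.\<close>

lemma joint_spectral_radius_eq:
  "joint_spectral_radius A B = (SUP w \<in> {w. w \<noteq> []}. ereal (exp (g w)))"
proof (rule antisym)
  define a where "a n = ereal (root n (Max ((\<lambda>Xs. spectral_radius (mat_prod Xs)) ` words A B n)))" for n
  have jsr: "joint_spectral_radius A B = limsup a"
    unfolding joint_spectral_radius_def a_def ..
  show "joint_spectral_radius A B \<le> (SUP w \<in> {w. w \<noteq> []}. ereal (exp (g w)))"
    unfolding jsr
  proof (rule Limsup_bounded)
    show "\<forall>\<^sub>F n in sequentially. a n \<le> (SUP w \<in> {w. w \<noteq> []}. ereal (exp (g w)))"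
      using eventually_ge_at_top[of 1]
    proof eventually_elim
      case (elim n)
      from root_Max_words(1)[OF this] obtain w where "length w = n" "a n = ereal (exp (g w))"
        unfolding a_def by auto
      then show ?case using elim by (auto intro!: SUP_upper2[of w])
    qed
  qed
  show "(SUP w \<in> {w. w \<noteq> []}. ereal (exp (g w))) \<le> joint_spectral_radius A B"
    unfolding jsr limsup_INF_SUP
  proof (intro SUP_least INF_greatest)
    fix w :: "bool list" and n assume "w \<in> {w. w \<noteq> []}"
    then have w: "w \<noteq> []" by simp
    define v where "v = concat (replicate (Suc n) w)"
    have len: "length v = Suc n * length w" unfolding v_def by (induction n) auto
    then have "length v \<ge> Suc n" using w by (cases "length w") auto
    then have "length v \<ge> n" "length v \<ge> 1" by auto
    have "ereal (exp (g w)) = ereal (exp (g v))"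
      unfolding v_def using growth_replicate[OF pos w, of "Suc n"] by simp
    also have "\<dots> \<le> a (length v)"
      unfolding a_def using root_Max_words(2)[OF \<open>length v \<ge> 1\<close>] by simp
    also have "\<dots> \<le> (SUP m\<in>{n..}. a m)" using \<open>length v \<ge> n\<close> by (intro SUP_upper) auto
    finally show "ereal (exp (g w)) \<le> (SUP m\<in>{n..}. a m)" .
  qed
qed

lemma spectrum_maximizing_iff:
  "(\<exists>Xs. spectrum_maximizing A B Xs) \<longleftrightarrow> (\<exists>w. max_word (conjugate T A) (conjugate T B) w)"
proof -
  have "(\<exists>Xs. spectrum_maximizing A B Xs)
     \<longleftrightarrow> (\<exists>w. w \<noteq> [] \<and> ereal (exp (g w)) = joint_spectral_radius A B)"
  proof -
    have "(\<exists>Xs. spectrum_maximizing A B Xs) \<longleftrightarrow> (\<exists>w. length w \<ge> 1 \<and>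
       ereal (root (length w) (spectral_radius (wprod A B w))) = joint_spectral_radius A B)"
      unfolding spectrum_maximizing_def words_eq by (fastforce simp: mat_prod_map)
    also have "\<dots> \<longleftrightarrow> (\<exists>w. w \<noteq> [] \<and> ereal (exp (g w)) = joint_spectral_radius A B)"
      using root_perron[OF pos] by (auto simp: spectral_radius_wprod Suc_le_eq)
    finally show ?thesis .
  qed
  also have "\<dots> \<longleftrightarrow> (\<exists>w. max_word (conjugate T A) (conjugate T B) w)"
  proof -
    have "ereal (exp (g w)) = joint_spectral_radius A B \<longleftrightarrow> (\<forall>v. v \<noteq> [] \<longrightarrow> g v \<le> g w)"
      if "w \<noteq> []" for w
    proof
      assume "ereal (exp (g w)) = joint_spectral_radius A B"
      then have "ereal (exp (g v)) \<le> ereal (exp (g w))" if "v \<noteq> []" for v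
        unfolding joint_spectral_radius_eq using that by (auto intro!: SUP_upper2[of v])
      then show "\<forall>v. v \<noteq> [] \<longrightarrow> g v \<le> g w" by simp
    next
      assume "\<forall>v. v \<noteq> [] \<longrightarrow> g v \<le> g w"
      then show "ereal (exp (g w)) = joint_spectral_radius A B"
        unfolding joint_spectral_radius_eq using that
        by (intro antisym SUP_upper SUP_least) auto
    qed
    then show ?thesis unfolding max_word_def by auto
  qed
  finally show ?thesis .
qed

end

subsection \<open>Nested pairs and their normal form\<close>

text \<open>For matrices of trace at least 2 and determinant 1 with axes in the hyperbolic plane, the sign
  of \<open>det (A ** B - B ** A)\<close> tells whether the axes cross (positive), share an endpoint (zero) or
  are disjoint (negative).\<close>

definition nested :: "mat2 \<Rightarrow> mat2 \<Rightarrow> bool" where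
  "nested A B \<longleftrightarrow> pos_mat A \<and> pos_mat B \<and> det (A ** B - B ** A) < 0"

definition normal_form :: "mat2 \<Rightarrow> mat2 \<Rightarrow> bool" where
  "normal_form A B \<longleftrightarrow> pos_mat A \<and> pos_mat B \<and> A $ 1 $ 1 = A $ 2 $ 2 \<and> B $ 1 $ 1 = B $ 2 $ 2
     \<and> A $ 2 $ 1 > 0 \<and> B $ 1 $ 2 > 0 \<and> A $ 1 $ 2 * B $ 2 $ 1 < B $ 1 $ 2 * A $ 2 $ 1"

lemma diagonalize_traceless:
  fixes X :: mat2
  assumes "trace X = 0" "det X < 0"
  obtains T k where "invertible T" "k > 0" "X ** T = T ** mat2_of k 0 0 (- k)"
proof -
  define p q r k where "p = X $ 1 $ 1" and "q = X $ 1 $ 2" and "r = X $ 2 $ 1" and "k = sqrt (- det X)"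
  have X: "X = mat2_of p q r (- p)" using assms(1)
    by (simp add: mat2_eq_iff p_def q_def r_def trace_2x2 eq_neg_iff_add_eq_0)
  have k0: "k > 0" and k2: "k * k = p * p + q * r"
    using assms(2) by (simp_all add: k_def X det_2)
  show thesis
  proof (cases "q = 0")
    case False
    show thesis
      by (rule that[of "mat2_of q q (k - p) (- k - p)" k])
        (use False k0 k2 in \<open>auto simp: invertible_2x2_iff mat2_eq_iff X algebra_simps\<close>)
  next
    case True
    then have "k = p \<or> k = - p" using k2 by (simp add: square_eq_iff)
    then show thesis
    proof
      assume "k = p"
      show thesis
        by (rule that[of "mat2_of (2 * p) 0 r 1" k])
          (use True k0 \<open>k = p\<close> in \<open>auto simp: invertible_2x2_iff mat2_eq_iff X algebra_simps\<close>)
    next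
      assume "k = - p"
      show thesis
        by (rule that[of "mat2_of 0 (2 * p) 1 r" k])
          (use True k0 \<open>k = - p\<close> in \<open>auto simp: invertible_2x2_iff mat2_eq_iff X algebra_simps\<close>)
    qed
  qed
qed

text \<open>The right-hand side is the Gram determinant of the traceless parts of \<open>A\<close>
  and \<open>B\<close> for the trace form.\<close>

lemma det_commutator:
  fixes A B :: mat2
  shows "det (A ** B - B ** A) = ((trace A)\<^sup>2 - 4 * det A) * ((trace B)\<^sup>2 - 4 * det B) / 4
     - (trace (A ** B) - trace A * trace B / 2)\<^sup>2"
  by (simp add: det_2 trace_2x2 power2_eq_square field_simps)

text \<open>A negative commutator determinant only makes the square of the cross term
  \<open>I\<close> large; non-negativity decides its sign. Since \<open>I\<close> is
  \<open>2 * (x * y)\<close> plus a non-negative number, \<open>I\<close> at most 0 would give a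
  square of at most \<open>(2 * (x * y))\<^sup>2\<close>, which the discriminants bound too
  tightly.\<close>

lemma nested_cross_pos:
  assumes "nested A B"
  shows "trace (A ** B) > trace A * trace B / 2"
proof (rule ccontr)
  assume neg: "\<not> ?thesis"
  define x y P where "x = (A $ 1 $ 1 - A $ 2 $ 2) / 2" and "y = (B $ 1 $ 1 - B $ 2 $ 2) / 2"
    and "P = A $ 1 $ 2 * B $ 2 $ 1 + A $ 2 $ 1 * B $ 1 $ 2"
  have pos: "pos_mat A" "pos_mat B" and K: "det (A ** B - B ** A) < 0"
    using assms by (simp_all add: nested_def)
  have P: "P \<ge> 0" using pos by (simp add: P_def pos_mat_iff)
  define I where "I = trace (A ** B) - trace A * trace B / 2"
  have I: "I = 2 * (x * y) + P"
    by (simp add: x_def y_def P_def I_def trace_2x2 field_simps)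
  have q: "(trace A)\<^sup>2 - 4 * det A = 4 * (x * x) + 4 * (A $ 1 $ 2 * A $ 2 $ 1)"
    "(trace B)\<^sup>2 - 4 * det B = 4 * (y * y) + 4 * (B $ 1 $ 2 * B $ 2 $ 1)"
    by (simp_all add: x_def y_def trace_2x2 det_2 power2_eq_square field_simps)
  have le: "4 * (x * x) \<le> (trace A)\<^sup>2 - 4 * det A" "4 * (y * y) \<le> (trace B)\<^sup>2 - 4 * det B"
    unfolding q using pos by (simp_all add: pos_mat_iff)
  have "(4 * (x * x)) * (4 * (y * y)) \<le> ((trace A)\<^sup>2 - 4 * det A) * ((trace B)\<^sup>2 - 4 * det B)"
    using le order_trans[OF zero_le_square[of x], of "((trace A)\<^sup>2 - 4 * det A) / 4"]
    by (intro mult_mono) auto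
  moreover have "I\<^sup>2 > ((trace A)\<^sup>2 - 4 * det A) * ((trace B)\<^sup>2 - 4 * det B) / 4"
    using K unfolding det_commutator I_def by simp
  moreover have "I\<^sup>2 \<le> (2 * (x * y))\<^sup>2"
  proof -
    have "\<bar>I\<bar> \<le> \<bar>2 * (x * y)\<bar>" using neg I P unfolding I_def by linarith
    then show ?thesis by (simp only: abs_le_square_iff)
  qed
  moreover have "(2 * (x * y))\<^sup>2 = (4 * (x * x)) * (4 * (y * y)) / 4"
    by (simp add: power2_eq_square)
  ultimately show False by linarith
qed

text \<open>The zero off-diagonal entries of the commutator are a linear relation between the
  off-diagonal vectors of \<open>A\<close> and \<open>B\<close>, whose coefficients are the diagonal
  differences. The determinant of the two vectors is \<open>k\<close>, so the relation is
  trivial.\<close>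

lemma equal_diagonals:
  fixes A B :: mat2
  assumes "B ** A - A ** B = mat2_of k 0 0 (- k)" "k \<noteq> 0"
  shows "A $ 1 $ 1 = A $ 2 $ 2" "B $ 1 $ 1 = B $ 2 $ 2" "B $ 1 $ 2 * A $ 2 $ 1 - A $ 1 $ 2 * B $ 2 $ 1 = k"
proof -
  define \<alpha> \<beta> where "\<alpha> = A $ 1 $ 1 - A $ 2 $ 2" and "\<beta> = B $ 1 $ 1 - B $ 2 $ 2"
  have e: "A $ 1 $ 2 * \<beta> = B $ 1 $ 2 * \<alpha>" "A $ 2 $ 1 * \<beta> = B $ 2 $ 1 * \<alpha>"
    and k: "B $ 1 $ 2 * A $ 2 $ 1 - A $ 1 $ 2 * B $ 2 $ 1 = k"
    using arg_cong[OF assms(1), of "\<lambda>X. X $ 1 $ 2"] arg_cong[OF assms(1), of "\<lambda>X. X $ 2 $ 1"]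
      arg_cong[OF assms(1), of "\<lambda>X. X $ 1 $ 1"]
    by (simp_all add: \<alpha>_def \<beta>_def) argo+
  have "k * \<alpha> = (B $ 1 $ 2 * \<alpha>) * A $ 2 $ 1 - A $ 1 $ 2 * (B $ 2 $ 1 * \<alpha>)"
    by (simp add: k[symmetric] algebra_simps)
  also have "\<dots> = 0" unfolding e[symmetric] by simp
  finally have "\<alpha> = 0" using assms(2) by simp
  have "k * \<beta> = B $ 1 $ 2 * (A $ 2 $ 1 * \<beta>) - (A $ 1 $ 2 * \<beta>) * B $ 2 $ 1"
    by (simp add: k[symmetric] algebra_simps)
  also have "\<dots> = 0" unfolding e by simp
  finally have "\<beta> = 0" using assms(2) by simp
  show "A $ 1 $ 1 = A $ 2 $ 2" "B $ 1 $ 1 = B $ 2 $ 2"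
    using \<open>\<alpha> = 0\<close> \<open>\<beta> = 0\<close> by (simp_all add: \<alpha>_def \<beta>_def)
  show "B $ 1 $ 2 * A $ 2 $ 1 - A $ 1 $ 2 * B $ 2 $ 1 = k" by (fact k)
qed

text \<open>Diagonalizing the commutator may destroy non-negativity. The signs of the new entries
  are recovered from conjugation invariants: the discriminants give \<open>b * c\<close> and
  \<open>b' * c'\<close> non-negative, and \<open>nested_cross_pos\<close> together with
  \<open>k > 0\<close> gives \<open>b' * c > 0\<close>.\<close>

lemma nested_normal_form:
  assumes "nested A B"
  obtains T where "invertible T" "normal_form (conjugate T A) (conjugate T B)"
proof -
  have pos: "pos_mat A" "pos_mat B" and K: "det (A ** B - B ** A) < 0"
    using assms by (simp_all add: nested_def)
  have "trace (B ** A - A ** B) = 0" "det (B ** A - A ** B) < 0"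
    using K by (simp_all add: trace_2x2 det_2 algebra_simps)
  then obtain T k where T: "invertible T" "k > 0" "(B ** A - A ** B) ** T = T ** mat2_of k 0 0 (- k)"
    by (rule diagonalize_traceless)
  define A' B' where "A' = conjugate T A" and "B' = conjugate T B"
  have "B' ** A' - A' ** B' = conjugate T (B ** A - A ** B)"
    by (simp add: A'_def B'_def conjugate_diff conjugate_mult T)
  also have "\<dots> = mat2_of k 0 0 (- k)" using T by (intro conjugate_eqI)
  finally have K': "B' ** A' - A' ** B' = mat2_of k 0 0 (- k)" .
  define a b c a' b' c' where "a = A' $ 1 $ 1" and "b = A' $ 1 $ 2" and "c = A' $ 2 $ 1"
    and "a' = B' $ 1 $ 1" and "b' = B' $ 1 $ 2" and "c' = B' $ 2 $ 1"
  have k: "b' * c - b * c' = k" and eq: "A' = mat2_of a b c a" "B' = mat2_of a' b' c' a'"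
    using equal_diagonals[OF K'] T(2)
    by (simp_all add: a_def b_def c_def a'_def b'_def c'_def mat2_eq_iff)
  have tr: "trace A' = trace A" "det A' = det A" "trace B' = trace B" "det B' = det B"
    "trace (A' ** B') = trace (A ** B)"
    by (simp_all add: A'_def B'_def trace_conjugate det_conjugate T flip: conjugate_mult)
  have "2 * a > 0" "2 * a' > 0" using pos_mat_trace_pos[OF pos(1)] pos_mat_trace_pos[OF pos(2)]
    unfolding tr[symmetric] by (simp_all add: eq trace_2x2)
  then have a: "a > 0" "a' > 0" by simp_all
  have d: "a * a - b * c > 0" "a' * a' - b' * c' > 0"
    using pos tr by (simp_all add: pos_mat_def eq det_2)
  have "4 * (b * c) \<ge> 0" "4 * (b' * c') \<ge> 0"
    using pos_mat_disc[OF pos(1)] pos_mat_disc[OF pos(2)] unfolding tr[symmetric]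
    by (simp_all add: eq trace_2x2 det_2 power2_eq_square algebra_simps)
  then have bc: "b * c \<ge> 0" "b' * c' \<ge> 0" by simp_all
  have "b * c' + b' * c > 0"
    using nested_cross_pos[OF assms] unfolding tr[symmetric]
    by (simp add: eq trace_2x2 algebra_simps)
  then have "b' * c > 0" using k T(2) by simp
  then consider "b' > 0" "c > 0" | "b' < 0" "c < 0" by (auto simp: zero_less_mult_iff)
  then show thesis
  proof cases
    case 1
    then have "b \<ge> 0" "c' \<ge> 0" using bc by (simp_all add: zero_le_mult_iff)
    with 1 a d k T have "normal_form A' B'"
      by (auto simp: normal_form_def eq pos_mat_iff algebra_simps)
    then show thesis using that T(1) by (simp add: A'_def B'_def)
  next
    case 2
    \<comment> \<open>Here no off-diagonal entry is positive; conjugation by \<open>D\<close> flips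
      their signs.\<close>
    define D where "D = mat2_of 1 0 0 (-1)"
    have D: "invertible D" by (simp add: D_def invertible_2x2_iff)
    have "conjugate D A' = mat2_of a (- b) (- c) a" "conjugate D B' = mat2_of a' (- b') (- c') a'"
      by (rule conjugate_eqI[OF D], simp add: mat2_eq_iff D_def eq)+
    moreover have "b \<le> 0" "c' \<le> 0" using bc 2 by (simp_all add: zero_le_mult_iff)
    ultimately have "normal_form (conjugate D A') (conjugate D B')"
      using 2 a d k T by (auto simp: normal_form_def pos_mat_iff algebra_simps)
    moreover have "invertible (T ** D)" using T D by (simp add: invertible_mult)
    ultimately show thesis using that[of "T ** D"]
      by (simp add: A'_def B'_def conjugate_conjugate T D)
  qed
qed

lemma nested_commute: "nested A B \<Longrightarrow> nested B A"
  by (simp add: nested_def det_2 algebra_simps)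

lemma nested_mult: "nested A B \<Longrightarrow> nested A (A ** B)"
proof -
  assume n: "nested A B"
  have "A ** (A ** B) - A ** B ** A = A ** (A ** B - B ** A)"
    by (simp add: mat2_eq_iff algebra_simps)
  then have "det (A ** (A ** B) - A ** B ** A) = det A * det (A ** B - B ** A)"
    by (simp only: det_mul)
  then show ?thesis using n by (simp add: nested_def pos_mat_mult mult_pos_neg) (simp add: pos_mat_def mult_pos_neg)
qed

lemma nested_scaleR:
  assumes "nested A B" "a > 0" "b > 0"
  shows "nested (a *\<^sub>R A) (b *\<^sub>R B)"
proof -
  have "a *\<^sub>R A ** b *\<^sub>R B - b *\<^sub>R B ** a *\<^sub>R A = (a * b) *\<^sub>R (A ** B - B ** A)"
    by (simp add: mat2_eq_iff algebra_simps)
  then have "det (a *\<^sub>R A ** b *\<^sub>R B - b *\<^sub>R B ** a *\<^sub>R A) = (a * b)\<^sup>2 * det (A ** B - B ** A)"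
    by (simp only: det_scaleR_2x2)
  then show ?thesis using assms by (simp add: nested_def pos_mat_scaleR mult_pos_neg)
qed

subsection \<open>Extremal words of a normalized pair\<close>

definition mob :: "mat2 \<Rightarrow> real \<Rightarrow> real" where
  "mob L z = (L $ 1 $ 1 * z + L $ 1 $ 2) / (L $ 2 $ 1 * z + L $ 2 $ 2)"

lemma mob_denom_pos: "pos_mat L \<Longrightarrow> z > 0 \<Longrightarrow> L $ 2 $ 1 * z + L $ 2 $ 2 > 0"
  by (simp add: pos_mat_iff add_nonneg_pos)

lemma mob_pos: "pos_mat L \<Longrightarrow> z > 0 \<Longrightarrow> mob L z > 0"
  unfolding mob_def by (intro divide_pos_pos mob_denom_pos) (auto simp: pos_mat_iff add_pos_nonneg)

lemma mob_mono:
  assumes "pos_mat L" "0 < y" "y \<le> z"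
  shows "mob L y \<le> mob L z"
proof -
  have "0 \<le> (L $ 1 $ 1 * L $ 2 $ 2 - L $ 1 $ 2 * L $ 2 $ 1) * (z - y)"
    using assms by (simp add: pos_mat_iff)
  then have "(L $ 1 $ 1 * y + L $ 1 $ 2) * (L $ 2 $ 1 * z + L $ 2 $ 2)
      \<le> (L $ 1 $ 1 * z + L $ 1 $ 2) * (L $ 2 $ 1 * y + L $ 2 $ 2)"
    by (simp add: algebra_simps)
  then show ?thesis unfolding mob_def
    using mob_denom_pos[OF assms(1), of y] mob_denom_pos[OF assms(1), of z] assms
    by (simp add: divide_le_eq pos_le_divide_eq)
qed

lemma mob_mult:
  assumes "pos_mat L" "pos_mat M" "z > 0"
  shows "mob L (mob M z) = mob (L ** M) z"
  using mob_denom_pos[OF assms(2,3)]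
    mob_denom_pos[OF pos_mat_mult[OF assms(1,2)] assms(3)]
    mob_denom_pos[OF assms(1) mob_pos[OF assms(2,3)]]
  unfolding mob_def by (simp add: divide_simps) (simp add: algebra_simps)

text \<open>For a matrix \<open>X\<close> with eigenvalue 1, the column \<open>(rfix X, 1)\<close> and the row \<open>(1, lfix X)\<close>
  are fixed by \<open>X\<close>.\<close>

definition rfix :: "mat2 \<Rightarrow> real" where
  "rfix X = (1 - X $ 2 $ 2) / X $ 2 $ 1"

definition lfix :: "mat2 \<Rightarrow> real" where
  "lfix X = (1 - X $ 1 $ 1) / X $ 2 $ 1"

definition unit_perron :: "mat2 \<Rightarrow> bool" where
  "unit_perron X \<longleftrightarrow> X $ 1 $ 2 > 0 \<and> X $ 2 $ 1 > 0 \<and> pos_mat X \<and> det X \<le> 1 \<and> trace X = 1 + det X"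

text \<open>The identity minus \<open>X\<close> has rank one: it is \<open>X $ 2 $ 1\<close> times
  the column \<open>(lfix X, -1)\<close> times the row \<open>(1, - rfix X)\<close>. So
  \<open>X\<close> is determined by its two fixed vectors and one scale.\<close>

lemma unit_perron_facts:
  assumes "unit_perron X"
  shows "rfix X > 0" "lfix X > 0"
    "X $ 1 $ 1 = 1 - lfix X * X $ 2 $ 1" "X $ 2 $ 2 = 1 - rfix X * X $ 2 $ 1"
    "X $ 1 $ 2 = rfix X * lfix X * X $ 2 $ 1"
    "det X = 1 - X $ 2 $ 1 * (rfix X + lfix X)"
proof -
  have X: "X $ 1 $ 2 > 0" "X $ 2 $ 1 > 0" "det X \<le> 1" "trace X = 1 + det X" "det X > 0"
    using assms by (simp_all add: unit_perron_def pos_mat_def)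
  have p: "(1 - X $ 1 $ 1) * (1 - X $ 2 $ 2) = X $ 1 $ 2 * X $ 2 $ 1"
    using X(4) by (simp add: trace_2x2 det_2 algebra_simps)
  moreover have "(1 - X $ 1 $ 1) + (1 - X $ 2 $ 2) = 1 - det X"
    using X(4) by (simp add: trace_2x2)
  moreover have "X $ 1 $ 2 * X $ 2 $ 1 > 0" using X by simp
  ultimately have "1 - X $ 1 $ 1 > 0 \<and> 1 - X $ 2 $ 2 > 0"
    using X(3) by (smt (verit) zero_less_mult_iff)
  then show "rfix X > 0" "lfix X > 0" using X by (simp_all add: rfix_def lfix_def)
  show 1: "X $ 1 $ 1 = 1 - lfix X * X $ 2 $ 1" "X $ 2 $ 2 = 1 - rfix X * X $ 2 $ 1"
    using X by (simp_all add: rfix_def lfix_def)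
  have "rfix X * lfix X * X $ 2 $ 1 = ((1 - X $ 1 $ 1) * (1 - X $ 2 $ 2)) / X $ 2 $ 1"
    using X by (simp add: rfix_def lfix_def)
  also have "\<dots> = X $ 1 $ 2" unfolding p using X by simp
  finally show "X $ 1 $ 2 = rfix X * lfix X * X $ 2 $ 1" ..
  have "det X = trace X - 1" using X by simp
  also have "\<dots> = 1 - X $ 2 $ 1 * (rfix X + lfix X)"
    unfolding trace_2x2 1 by (simp add: algebra_simps)
  finally show "det X = 1 - X $ 2 $ 1 * (rfix X + lfix X)" .
qed

lemma rfix_eqI:
  assumes "unit_perron X" "X $ 2 $ 1 * x + X $ 2 $ 2 * y = y" "y \<noteq> 0"
  shows "rfix X = x / y"
proof -
  have "X $ 2 $ 1 * (x - rfix X * y) = 0"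
    using assms(2) unfolding unit_perron_facts(4)[OF assms(1)] by (simp add: algebra_simps)
  then show ?thesis using assms by (simp add: unit_perron_def field_simps)
qed

text \<open>The characteristic polynomial of \<open>X ** Y\<close> at 1 is a negative multiple of
  the product of the two differences. A product that does not exceed spectral radius 1 therefore
  forces left and right fixed points into opposite orders.\<close>

lemma fix_antitone:
  assumes X: "unit_perron X" and Y: "unit_perron Y" and le: "trace (X ** Y) \<le> 1 + det (X ** Y)"
  shows "(rfix X - rfix Y) * (lfix X - lfix Y) \<le> 0"
proof -
  define g h where "g = X $ 2 $ 1" and "h = Y $ 2 $ 1"
  have gh: "g > 0" "h > 0" using X Y by (simp_all add: g_def h_def unit_perron_def)
  have "trace (X ** Y) - (1 + det (X ** Y)) = (g * h) * ((rfix X - rfix Y) * (lfix X - lfix Y))"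
    unfolding det_mul trace_2x2 mult_2x2 unit_perron_facts(3-6)[OF X] unit_perron_facts(3-6)[OF Y]
      g_def[symmetric] h_def[symmetric]
    by (simp add: algebra_simps)
  then have "(g * h) * ((rfix X - rfix Y) * (lfix X - lfix Y)) \<le> 0" using le by linarith
  then show ?thesis using gh by (simp add: mult_le_0_iff zero_less_mult_iff)
qed

text \<open>\<open>L\<close> maps a fixed vector of \<open>U ** L\<close> to a fixed vector of
  \<open>L ** U\<close>.\<close>

lemma rfix_rotate:
  assumes L: "pos_mat L" and X: "unit_perron (L ** U)" and Y: "unit_perron (U ** L)"
  shows "rfix (L ** U) = mob L (rfix (U ** L))"
proof -
  define s where "s = rfix (U ** L)"
  define x y where "x = L $ 1 $ 1 * s + L $ 1 $ 2" and "y = L $ 2 $ 1 * s + L $ 2 $ 2"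
  have s: "s > 0" using unit_perron_facts(1)[OF Y] by (simp add: s_def)
  have f1: "(U ** L) $ 2 $ 1 * s + (U ** L) $ 2 $ 2 = 1"
    using unit_perron_facts(4)[OF Y] unfolding s_def[symmetric] by (simp add: algebra_simps)
  have f2: "(U ** L) $ 1 $ 1 * s + (U ** L) $ 1 $ 2 = s"
    unfolding unit_perron_facts(3,5)[OF Y] s_def[symmetric] by (simp del: mult_2x2 add: algebra_simps)
  have g: "U $ 2 $ 1 * x + U $ 2 $ 2 * y = 1" "U $ 1 $ 1 * x + U $ 1 $ 2 * y = s"
    using f1 f2 by (simp_all add: x_def y_def algebra_simps)
  have "(L ** U) $ 2 $ 1 * x + (L ** U) $ 2 $ 2 * y
      = L $ 2 $ 1 * (U $ 1 $ 1 * x + U $ 1 $ 2 * y) + L $ 2 $ 2 * (U $ 2 $ 1 * x + U $ 2 $ 2 * y)"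
    by (simp add: algebra_simps)
  also have "\<dots> = y" unfolding g by (simp add: y_def)
  finally have "rfix (L ** U) = x / y"
    using mob_denom_pos[OF L s] by (intro rfix_eqI[OF X]) (auto simp: y_def)
  then show ?thesis by (simp add: mob_def x_def y_def s_def)
qed

text \<open>For \<open>M = A ** B\<close>, the hypothesis on \<open>U\<close> says that the exchange of \<open>A ** B ** U\<close> for
  \<open>B ** A ** U\<close> does not increase the trace.\<close>

lemma swap_order:
  assumes M: "pos_mat M" and m: "M $ 1 $ 1 < M $ 2 $ 2"
    and U: "U $ 1 $ 1 \<le> U $ 2 $ 2"
    and X: "unit_perron (M ** U)" and Y: "unit_perron (U ** M)"
  shows "rfix (U ** M) \<le> lfix (M ** U)"
proof -
  define X where "X = M ** U"
  define s t g p where "s = rfix X" and "t = lfix X" and "g = X $ 2 $ 1" and "p = rfix (U ** M)"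
  define m1 n k m2 where "m1 = M $ 1 $ 1" and "n = M $ 1 $ 2" and "k = M $ 2 $ 1" and "m2 = M $ 2 $ 2"
  have uX: "unit_perron X" using X by (simp add: X_def)
  have s: "s > 0" and t: "t > 0" using unit_perron_facts(1,2)[OF uX] by (simp_all add: s_def t_def)
  have g: "g > 0" using uX by (simp add: g_def unit_perron_def)
  have p: "p > 0" using unit_perron_facts(1)[OF Y] by (simp add: p_def)
  have D: "m1 * m2 - n * k > 0" using M by (simp add: pos_mat_iff m1_def m2_def n_def k_def)
  have den: "k * p + m2 > 0" using mob_denom_pos[OF M p] by (simp add: k_def m2_def)
  have "s = mob M p" unfolding s_def p_def X_def by (rule rfix_rotate[OF M X Y])
  then have sp: "s * (k * p + m2) = m1 * p + n"
    using den by (simp add: mob_def m1_def n_def k_def m2_def)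
  \<comment> \<open>\<open>det M\<close> times \<open>U\<close> is the adjugate of \<open>M\<close>
    times \<open>X\<close>, so the diagonal of \<open>U\<close> can be read off from
    \<open>X\<close>.\<close>
  have U11: "(m1 * m2 - n * k) * U $ 1 $ 1 = m2 * X $ 1 $ 1 - n * X $ 2 $ 1"
    and U22: "(m1 * m2 - n * k) * U $ 2 $ 2 = m1 * X $ 2 $ 2 - k * X $ 1 $ 2"
    by (simp_all add: X_def m1_def n_def k_def m2_def algebra_simps)
  have "(m1 * m2 - n * k) * U $ 1 $ 1 \<le> (m1 * m2 - n * k) * U $ 2 $ 2"
    using U D by simp
  then have "m2 * (1 - t * g) - n * g \<le> m1 * (1 - s * g) - k * (s * t * g)"
    unfolding U11 U22 unit_perron_facts(3-5)[OF uX] s_def[symmetric] t_def[symmetric] g_def[symmetric] .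
  then have 1: "g * (m2 * s - n - t * m1 + k * s * t) \<le> - ((m2 - m1) * (1 - g * (s + t)))"
    by (simp add: algebra_simps)
  have "1 - g * (s + t) = det X" using unit_perron_facts(6)[OF uX] by (simp add: s_def t_def g_def)
  then have "1 - g * (s + t) > 0" using uX by (simp add: unit_perron_def pos_mat_def)
  then have "(m2 - m1) * (1 - g * (s + t)) > 0" using m by (simp add: m1_def m2_def)
  with 1 have "g * (m2 * s - n - t * m1 + k * s * t) < 0" by linarith
  then have 2: "m2 * s - n - t * m1 + k * s * t < 0" using g by (simp add: mult_less_0_iff)
  \<comment> \<open>Multiplying by the denominator of \<open>mob M p\<close> eliminates
    \<open>s\<close> in favour of \<open>p\<close>, and \<open>det M\<close> splits off.\<close>
  have "(m2 * s - n - t * m1 + k * s * t) * (k * p + m2)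
      = m2 * (s * (k * p + m2)) - n * (k * p + m2) - t * m1 * (k * p + m2) + k * t * (s * (k * p + m2))"
    by (simp add: algebra_simps)
  also have "\<dots> = (m1 * m2 - n * k) * (p - t)" unfolding sp by (simp add: algebra_simps)
  finally have "(m1 * m2 - n * k) * (p - t) < 0"
    using 2 den by (metis mult_neg_pos)
  then have "p < t" using D by (simp add: mult_less_0_iff)
  then show ?thesis by (simp add: p_def t_def X_def)
qed

text \<open>Reflection in the antidiagonal: an anti-automorphism that fixes exactly the matrices
  with equal diagonal entries.\<close>

definition star :: "mat2 \<Rightarrow> mat2" where
  "star X = mat2_of (X $ 2 $ 2) (X $ 1 $ 2) (X $ 2 $ 1) (X $ 1 $ 1)"

lemma star_mult: "star (X ** Y) = star Y ** star X"
  by (simp add: star_def mat2_eq_iff algebra_simps)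

lemma wprod_rev:
  assumes "star A = A" "star B = B"
  shows "wprod A B (rev w) = star (wprod A B w)"
  using assms
  by (induction w) (auto simp: wprod_append star_mult, simp add: star_def mat2_eq_iff)

lemma unit_perron_star: "unit_perron (star X) \<longleftrightarrow> unit_perron X"
  by (auto simp: unit_perron_def star_def pos_mat_iff det_2 trace_2x2 algebra_simps)

lemma rfix_star: "rfix (star X) = lfix X" and lfix_star: "lfix (star X) = rfix X"
  by (simp_all add: rfix_def lfix_def star_def)

lemma wprod_entries:
  assumes "normal_form A B"
  shows "pos_mat (wprod A B w)"
    and "True \<in> set w \<or> (w \<noteq> [] \<and> A $ 1 $ 2 > 0) \<Longrightarrow> wprod A B w $ 1 $ 2 > 0"
    and "False \<in> set w \<or> (w \<noteq> [] \<and> B $ 2 $ 1 > 0) \<Longrightarrow> wprod A B w $ 2 $ 1 > 0"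
proof -
  have p: "pos_mat A" "pos_mat B" using assms by (simp_all add: normal_form_def)
  show P: "pos_mat (wprod A B w)" for w by (intro wprod_pos p)
  show "True \<in> set w \<or> (w \<noteq> [] \<and> A $ 1 $ 2 > 0) \<Longrightarrow> wprod A B w $ 1 $ 2 > 0"
  proof (induction w)
    case (Cons x w)
    show ?case
    proof (cases "x \<or> A $ 1 $ 2 > 0")
      case True
      then show ?thesis using P[of w] assms
        by (auto simp: normal_form_def pos_mat_iff intro!: add_nonneg_pos)
    next
      case False
      then have "wprod A B w $ 1 $ 2 > 0" using Cons by auto
      then show ?thesis using False P[of w] assms
        by (auto simp: normal_form_def pos_mat_iff intro!: add_pos_nonneg)
    qed
  qed simp
  show "False \<in> set w \<or> (w \<noteq> [] \<and> B $ 2 $ 1 > 0) \<Longrightarrow> wprod A B w $ 2 $ 1 > 0"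
  proof (induction w)
    case (Cons x w)
    show ?case
    proof (cases "\<not> x \<or> B $ 2 $ 1 > 0")
      case True
      then show ?thesis using P[of w] assms
        by (auto simp: normal_form_def pos_mat_iff intro!: add_pos_nonneg)
    next
      case False
      then have "wprod A B w $ 2 $ 1 > 0" using Cons by auto
      then show ?thesis using False P[of w] assms
        by (auto simp: normal_form_def pos_mat_iff intro!: add_nonneg_pos)
    qed
  qed simp
qed

definition subunit :: "mat2 \<Rightarrow> mat2 \<Rightarrow> bool" where
  "subunit A B \<longleftrightarrow> (\<forall>w. det (wprod A B w) \<le> 1 \<and> trace (wprod A B w) \<le> 1 + det (wprod A B w))"

text \<open>The empty word has trace 2 and determinant 1 and would satisfy the equation, hence its
  exclusion.\<close>

definition unit_word :: "mat2 \<Rightarrow> mat2 \<Rightarrow> bool list \<Rightarrow> bool" where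
  "unit_word A B w \<longleftrightarrow> w \<noteq> [] \<and> trace (wprod A B w) = 1 + det (wprod A B w)"

text \<open>A product with a vanishing off-diagonal entry would be a power of a parabolic letter, whose
  powers grow without bound when multiplied by the other letter.\<close>

lemma unit_word_upper_pos:
  assumes nf: "normal_form A B" and sub: "subunit A B" and w: "unit_word A B w"
  shows "wprod A B w $ 1 $ 2 > 0"
proof (rule ccontr)
  assume neg: "\<not> ?thesis"
  then have "True \<notin> set w" and A12: "A $ 1 $ 2 = 0"
    using wprod_entries(2)[OF nf] w nf
    by (force simp: unit_word_def normal_form_def pos_mat_iff)+
  then have rep: "w = replicate (length w) False"
    by (metis (full_types) replicate_length_same)
  define a c where "a = A $ 1 $ 1" and "c = A $ 2 $ 1"
  have A: "A = mat2_of a 0 c a" and a: "a > 0" and c: "c > 0"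
    using A12 nf by (auto simp: mat2_eq_iff normal_form_def a_def c_def pos_mat_iff)
  have pw: "wprod A B (replicate n False) $ 1 $ 1 = a ^ n \<and> wprod A B (replicate n False) $ 1 $ 2 = 0
     \<and> wprod A B (replicate n False) $ 2 $ 2 = a ^ n" for n
    by (induction n) (auto simp: A)
  have "a ^ length w + a ^ length w = 1 + a ^ length w * a ^ length w"
    using w pw[of "length w"] rep[symmetric] by (simp add: unit_word_def trace_2x2 det_2)
  then have "(a ^ length w - 1)\<^sup>2 = 0" by (simp add: power2_eq_square algebra_simps)
  then have "a ^ length w = 1" by simp
  then have "a = 1" using a w power_eq_iff_eq_base[of "length w" a 1] by (simp add: unit_word_def)
  have pw2: "wprod A B (replicate n False @ [True]) = mat2_of 1 0 (n * c) 1 ** B" for n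
  proof (induction n)
    case 0
    then show ?case by (simp add: mat2_eq_iff)
  next
    case (Suc n)
    then show ?case unfolding replicate_Suc append_Cons wprod.simps by (simp add: mat2_eq_iff A \<open>a = 1\<close> distrib_right distrib_left)
  qed
  have cb: "c * B $ 1 $ 2 > 0" using c nf by (simp add: normal_form_def)
  then obtain n :: nat where "n * (c * B $ 1 $ 2) > 2" using ex_less_of_nat_mult by blast
  moreover have "trace (wprod A B (replicate n False @ [True])) \<le> 2"
    using sub[unfolded subunit_def, rule_format, of "replicate n False @ [True]"] by linarith
  ultimately show False using nf
    unfolding pw2 by (simp add: trace_2x2 normal_form_def pos_mat_iff algebra_simps)
qed

lemma unit_word_lower_pos:
  assumes nf: "normal_form A B" and sub: "subunit A B" and w: "unit_word A B w"
  shows "wprod A B w $ 2 $ 1 > 0"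
proof (rule ccontr)
  assume neg: "\<not> ?thesis"
  then have "False \<notin> set w" and B21: "B $ 2 $ 1 = 0"
    using wprod_entries(3)[OF nf] w nf
    by (force simp: unit_word_def normal_form_def pos_mat_iff)+
  then have rep: "w = replicate (length w) True"
    by (metis (full_types) replicate_length_same)
  define a c where "a = B $ 1 $ 1" and "c = B $ 1 $ 2"
  have B: "B = mat2_of a c 0 a" and a: "a > 0" and c: "c > 0"
    using B21 nf by (auto simp: mat2_eq_iff normal_form_def a_def c_def pos_mat_iff)
  have pw: "wprod A B (replicate n True) $ 1 $ 1 = a ^ n \<and> wprod A B (replicate n True) $ 2 $ 1 = 0
     \<and> wprod A B (replicate n True) $ 2 $ 2 = a ^ n" for n
    by (induction n) (auto simp: B)
  have "a ^ length w + a ^ length w = 1 + a ^ length w * a ^ length w"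
    using w pw[of "length w"] rep[symmetric] by (simp add: unit_word_def trace_2x2 det_2)
  then have "(a ^ length w - 1)\<^sup>2 = 0" by (simp add: power2_eq_square algebra_simps)
  then have "a ^ length w = 1" by simp
  then have "a = 1" using a w power_eq_iff_eq_base[of "length w" a 1] by (simp add: unit_word_def)
  have pw2: "wprod A B (replicate n True @ [False]) = mat2_of 1 (n * c) 0 1 ** A" for n
  proof (induction n)
    case 0
    then show ?case by (simp add: mat2_eq_iff)
  next
    case (Suc n)
    then show ?case unfolding replicate_Suc append_Cons wprod.simps by (simp add: mat2_eq_iff B \<open>a = 1\<close> distrib_right distrib_left)
  qed
  have cb: "c * A $ 2 $ 1 > 0" using c nf by (simp add: normal_form_def)
  then obtain n :: nat where "n * (c * A $ 2 $ 1) > 2" using ex_less_of_nat_mult by blast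
  moreover have "trace (wprod A B (replicate n True @ [False])) \<le> 2"
    using sub[unfolded subunit_def, rule_format, of "replicate n True @ [False]"] by linarith
  ultimately show False using nf
    unfolding pw2 by (simp add: trace_2x2 normal_form_def pos_mat_iff algebra_simps)
qed

lemma unit_word_unit_perron:
  assumes "normal_form A B" "subunit A B" "unit_word A B w"
  shows "unit_perron (wprod A B w)"
  using unit_word_upper_pos[OF assms] unit_word_lower_pos[OF assms] wprod_entries(1)[OF assms(1)] assms(2,3)
  by (simp add: unit_perron_def unit_word_def subunit_def)

lemma unit_word_rotate: "unit_word A B (v @ w) \<Longrightarrow> unit_word A B (w @ v)"
  unfolding unit_word_def wprod_append det_mul trace_mul_sym[of "wprod A B w" "wprod A B v"]
  by (auto simp: mult.commute)

section \<open>The exchange argument for a normalized pair\<close>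

context
  fixes A B :: mat2
  assumes nf: "normal_form A B" and sub: "subunit A B"
begin

private abbreviation "W \<equiv> wprod A B"
private abbreviation "letter x \<equiv> (if x then B else A)"

private lemma pos: "pos_mat A" "pos_mat B" "pos_mat (letter x)"
  using nf by (auto simp: normal_form_def)

private lemma star_letter: "star A = A" "star B = B" "star (letter x) = letter x"
  using nf by (auto simp: normal_form_def star_def mat2_eq_iff)

private lemma up: "unit_word A B w \<Longrightarrow> unit_perron (W w)"
  by (rule unit_word_unit_perron[OF nf sub])

private lemma trace_star: "trace (star X) = trace X" and det_star: "det (star X) = det X"
  by (simp_all add: star_def trace_2x2 det_2)

lemma unit_word_rev: "unit_word A B w \<Longrightarrow> unit_word A B (rev w)"
  unfolding unit_word_def wprod_rev[OF star_letter(1,2)] trace_star det_star by simp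

private lemma fix_rev: "rfix (W (rev w)) = lfix (W w)" "lfix (W (rev w)) = rfix (W w)"
  by (simp_all add: wprod_rev star_letter rfix_star lfix_star)

private lemma rfix_Cons:
  assumes "unit_word A B (x # u)"
  shows "rfix (W (x # u)) = mob (letter x) (rfix (W (u @ [x])))"
proof -
  have "unit_word A B (u @ [x])" using unit_word_rotate[of A B "[x]" u] assms by simp
  then show ?thesis using rfix_rotate[OF pos(3)[of x], of "W u"] up[OF assms] up[of "u @ [x]"]
    by (simp add: wprod_append)
qed

private lemma lfix_snoc:
  assumes "unit_word A B (u @ [x])"
  shows "lfix (W (u @ [x])) = mob (letter x) (lfix (W (x # u)))"
  using rfix_Cons[of x "rev u"] unit_word_rev[OF assms] fix_rev(1)[of "u @ [x]"] fix_rev(1)[of "x # u"]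
  by (simp del: wprod.simps)

private lemma antitone:
  assumes "unit_word A B v" "unit_word A B w"
  shows "(rfix (W v) - rfix (W w)) * (lfix (W v) - lfix (W w)) \<le> 0"
  using fix_antitone[OF up[OF assms(1)] up[OF assms(2)]] sub
  unfolding subunit_def wprod_append[symmetric] by blast

private lemma rfix_pos: "unit_word A B w \<Longrightarrow> rfix (W w) > 0"
  using unit_perron_facts(1) up by blast

text \<open>\<open>A ** B\<close> and \<open>B ** A\<close> have the same off-diagonal entries and
  exchanged diagonal ones. The last inequality of the normal form says which diagonal entry is
  larger.\<close>

private lemma mob_AB_less: "z > 0 \<Longrightarrow> mob A (mob B z) < mob B (mob A z)"
proof -
  assume z: "z > 0"
  define m1 m2 n k where "m1 = (A ** B) $ 1 $ 1" and "m2 = (A ** B) $ 2 $ 2"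
    and "n = (A ** B) $ 1 $ 2" and "k = (A ** B) $ 2 $ 1"
  have m: "m1 < m2" using nf by (simp add: normal_form_def m1_def m2_def algebra_simps)
  have BA: "(B ** A) $ 1 $ 1 = m2" "(B ** A) $ 2 $ 2 = m1" "(B ** A) $ 1 $ 2 = n" "(B ** A) $ 2 $ 1 = k"
    using nf by (simp_all add: normal_form_def m1_def m2_def n_def k_def algebra_simps)
  have ps: "pos_mat (A ** B)" using pos by (simp add: pos_mat_mult)
  have nn: "m1 > 0" "n \<ge> 0" "k \<ge> 0" using ps unfolding pos_mat_iff by (auto simp only: m1_def n_def k_def)
  have "(m1 * z + n) / (k * z + m2) < (m2 * z + n) / (k * z + m1)"
    using nn m z by (intro frac_less) (auto intro: add_nonneg_pos)
  then show ?thesis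
    using pos z by (simp only: mob_mult) (simp only: mob_def BA m1_def m2_def n_def k_def)
qed

text \<open>Let \<open>Z\<close> and \<open>z\<close> be the extreme fixed points over all rotations of unit words of bounded length.
  They occur together, at a position between the last letter \<open>A\<close> and the first letter \<open>B\<close>. Exchanging
  these two letters does not increase the trace, so every fixed point in the range of
  \<open>A\<close> lies below every fixed point in the range of \<open>B\<close>, against antitonicity.\<close>

lemma not_both_squares:
  assumes w: "unit_word A B w" "\<not> hd w" "\<not> last w"
    and w': "unit_word A B w'" "hd w'" "last w'"
  shows False
proof -
  define r l where "r v = rfix (W v)" and "l v = lfix (W v)" for v
  \<comment> \<open>Finite, so that extremes are attained, and closed under rotation and
    reversal.\<close>
  define S where "S = {v. unit_word A B v \<and> length v \<le> max (length w) (length w')}"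
  have S_uw: "unit_word A B v" if "v \<in> S" for v using that by (simp add: S_def)
  have S_rev: "rev v \<in> S" if "v \<in> S" for v using that unit_word_rev by (simp add: S_def)
  have S_rot: "u @ [x] \<in> S" if "x # u \<in> S" for x u
    using that unit_word_rotate[of A B "[x]" u] by (simp add: S_def)
  have wS: "w \<in> S" "w' \<in> S" using w w' by (simp_all add: S_def)
  have "finite S" unfolding S_def
    by (rule finite_subset[OF _ finite_bool_lists_le[of "max (length w) (length w')"]]) auto
  define Z where "Z = Max (r ` S)"
  define z where "z = Min (l ` S)"
  have ZU: "r v \<le> Z" and zL: "z \<le> l v" if "v \<in> S" for v
    using that \<open>finite S\<close> by (simp_all add: Z_def z_def)
  have rev: "r (rev v) = l v" "l (rev v) = r v" for v by (simp_all add: r_def l_def fix_rev)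
  \<comment> \<open>Reversal exchanges \<open>r\<close> and \<open>l\<close> within
    \<open>S\<close>, so \<open>Z\<close> and \<open>z\<close> bound both of them.\<close>
  have ZL: "l v \<le> Z" and zU: "z \<le> r v" if "v \<in> S" for v
    using ZU[OF S_rev[OF that]] zL[OF S_rev[OF that]] by (simp_all add: rev)
  have rpos: "r v > 0" if "v \<in> S" for v using rfix_pos S_uw[OF that] by (simp add: r_def)
  have anti: "(r u - r v) * (l u - l v) \<le> 0" if "u \<in> S" "v \<in> S" for u v
    using antitone[OF S_uw[OF that(1)] S_uw[OF that(2)]] by (simp add: r_def l_def)
  have rC: "r (x # u) = mob (letter x) (r (u @ [x]))" if "x # u \<in> S" for x u
    using rfix_Cons[OF S_uw[OF that]] by (simp only: r_def)
  have lC: "l (u @ [x]) = mob (letter x) (l (x # u))" if "u @ [x] \<in> S" for x u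
    using lfix_snoc[OF S_uw[OF that]] by (simp only: l_def)
  have "Z \<in> r ` S" "z \<in> l ` S" unfolding Z_def z_def using \<open>finite S\<close> wS
    by (auto intro!: Max_in Min_in)
  then obtain u v where uv: "u \<in> S" "r u = Z" "v \<in> S" "l v = z" by auto
  \<comment> \<open>Both factors are non-negative, so one of them vanishes and a single word attains
    both extremes.\<close>
  have "(Z - r v) * (l u - z) \<le> 0" using anti[of u v] uv by simp
  moreover have "Z - r v \<ge> 0" "l u - z \<ge> 0" using ZU zL uv by simp_all
  ultimately have "Z = r v \<or> l u = z"
    by (metis antisym eq_iff_diff_eq_0 mult_eq_0_iff mult_nonneg_nonneg)
  then obtain w0 where w0: "w0 \<in> S" "r w0 = Z" "l w0 = z" using uv by metis
  have z0: "z > 0" using rpos[OF S_rev[OF w0(1)]] w0 by (simp add: rev)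
  have zZ: "z \<le> Z" using zU[OF w0(1)] w0 by simp
  have mono: "mob (letter x) y \<le> mob (letter x) y'" if "0 < y" "y \<le> y'" for x y y'
    by (rule mob_mono[OF pos(3) that])
  have hd_le: "r v \<le> mob (letter x) Z" and hd_ge: "mob (letter x) z \<le> r v"
    if "v \<in> S" "hd v = x" for x v
  proof -
    have "v \<noteq> []" using S_uw[OF that(1)] by (simp add: unit_word_def)
    then have v: "v = x # tl v" using that(2) by (cases v) auto
    then have t: "tl v @ [x] \<in> S" using S_rot that(1) by metis
    have "r v = mob (letter x) (r (tl v @ [x]))" using rC v that(1) by metis
    then show "r v \<le> mob (letter x) Z" "mob (letter x) z \<le> r v"
      using mono[OF rpos[OF t] ZU[OF t]] mono[OF z0 zU[OF t]] by simp_all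
  qed
  define a b c where "a = A $ 1 $ 1" and "b = A $ 1 $ 2" and "c = A $ 2 $ 1"
  define a' b' c' where "a' = B $ 1 $ 1" and "b' = B $ 1 $ 2" and "c' = B $ 2 $ 1"
  have AB: "A = mat2_of a b c a" "B = mat2_of a' b' c' a'"
    using nf by (simp_all add: mat2_eq_iff a_def b_def c_def a'_def b'_def c'_def normal_form_def)
  have pm: "a > 0" "a' > 0" "b \<ge> 0" "c > 0" "b' > 0" "c' \<ge> 0" "b * c' < b' * c"
    using nf by (simp_all add: AB normal_form_def pos_mat_iff)
  have mobA: "mob A y \<le> y \<longleftrightarrow> b \<le> c * y\<^sup>2" "y \<le> mob A y \<longleftrightarrow> c * y\<^sup>2 \<le> b" if "y > 0" for y
    using mob_denom_pos[OF pos(1) that]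
    by (simp_all add: mob_def AB divide_le_eq pos_le_divide_eq power2_eq_square algebra_simps)
  have mobB: "mob B y \<le> y \<longleftrightarrow> b' \<le> c' * y\<^sup>2" "y \<le> mob B y \<longleftrightarrow> c' * y\<^sup>2 \<le> b'" if "y > 0" for y
    using mob_denom_pos[OF pos(2) that]
    by (simp_all add: mob_def AB divide_le_eq pos_le_divide_eq power2_eq_square algebra_simps)
  \<comment> \<open>\<open>mob A\<close> fixes \<open>sqrt (b / c)\<close> and \<open>mob B\<close>
    fixes \<open>sqrt (b' / c')\<close>, the latter infinite if \<open>c' = 0\<close>. The normal
    form puts the first strictly below the second, so no point is at most the first and at least the
    second.\<close>
  have not_fixed: "\<not> (c * y\<^sup>2 \<le> b \<and> b' \<le> c' * y\<^sup>2)" for y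
  proof
    assume h: "c * y\<^sup>2 \<le> b \<and> b' \<le> c' * y\<^sup>2"
    have "b' * c \<le> (c' * y\<^sup>2) * c" using h pm by (intro mult_right_mono) auto
    also have "\<dots> = (c * y\<^sup>2) * c'" by simp
    also have "\<dots> \<le> b * c'" using h pm by (intro mult_right_mono) auto
    finally show False using pm by simp
  qed
  have "Z > 0" using z0 zZ by simp
  have sq: "z\<^sup>2 \<le> Z\<^sup>2" using z0 zZ by simp
  have w0rev: "r (rev w0) = z" "rev w0 \<in> S" using w0 by (simp_all add: rev S_rev)
  have ne: "w0 \<noteq> []" using S_uw[OF w0(1)] by (simp add: unit_word_def)
  have hdw0: "hd w0"
  proof (rule ccontr)
    assume "\<not> hd w0"
    then have "c * Z\<^sup>2 \<le> b" using hd_le[OF w0(1) refl] w0(2) mobA(2)[OF \<open>Z > 0\<close>] by simp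
    moreover have "b' \<le> c' * Z\<^sup>2"
    proof (cases "hd (rev w0)")
      case True
      then have "b' \<le> c' * z\<^sup>2" using hd_ge[OF w0rev(2) refl] w0rev(1) mobB(1)[OF z0] by simp
      then show ?thesis using sq pm by (meson mult_left_mono order_trans)
    next
      case False
      then have "b \<le> c * z\<^sup>2" using hd_ge[OF w0rev(2) refl] w0rev(1) mobA(1)[OF z0] by simp
      then have "c * Z\<^sup>2 \<le> c * z\<^sup>2" using \<open>c * Z\<^sup>2 \<le> b\<close> by simp
      then have "Z\<^sup>2 \<le> z\<^sup>2" using pm by simp
      then have "Z = z" using power2_le_imp_le[of Z z] z0 zZ by linarith
      \<comment> \<open>All fixed points now coincide, and \<open>w'\<close> supplies the missing
        word that begins with \<open>B\<close>.\<close>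
      then have "r w' = z" using ZU[OF wS(2)] zU[OF wS(2)] by simp
      then show ?thesis using hd_ge[OF wS(2), of True] w'(2) mobB(1)[OF z0] \<open>Z = z\<close> by simp
    qed
    ultimately show False using not_fixed by blast
  qed
  have lastw0: "\<not> last w0"
  proof
    assume "last w0"
    then have b: "b' \<le> c' * z\<^sup>2" using hd_ge[OF w0rev(2) refl] w0rev(1) mobB(1)[OF z0]
      by (simp add: hd_rev)
    have "c' * Z\<^sup>2 \<le> b'" using hd_le[OF w0(1) refl] hdw0 w0(2) mobB(2)[OF \<open>Z > 0\<close>] by simp
    then have "c' * Z\<^sup>2 \<le> c' * z\<^sup>2" using b by simp
    moreover have "c' > 0" using b pm by (cases "c' = 0") auto
    ultimately have "Z\<^sup>2 \<le> z\<^sup>2" by simp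
    then have "Z = z" using power2_le_imp_le[of Z z] z0 zZ by linarith
    then have "r w = z" using ZU[OF wS(1)] zU[OF wS(1)] by simp
    then have "c * z\<^sup>2 \<le> b" using hd_le[OF wS(1), of False] w(2) mobA(2)[OF z0] \<open>Z = z\<close> by simp
    then show False using not_fixed b by blast
  qed
  obtain u where u: "w0 = True # u @ [False]"
  proof -
    have "w0 = hd w0 # tl w0" using ne by simp
    moreover from this have "tl w0 \<noteq> []" using hdw0 lastw0 by (metis last_ConsL)
    then have "tl w0 = butlast (tl w0) @ [last w0]" by (metis append_butlast_last_id last_tl)
    ultimately show thesis using that hdw0 lastw0 by (metis (full_types))
  qed
  have Sp: "u @ [False, True] \<in> S" using S_rot[of True "u @ [False]"] w0(1) u by simp
  have Sm: "False # True # u \<in> S"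
  proof -
    have "rev w0 = False # rev u @ [True]" by (simp add: u)
    then have "rev u @ [True, False] \<in> S" using S_rot[of False "rev u @ [True]"] w0rev(2) by simp
    from S_rev[OF this] show ?thesis by simp
  qed
  have Zeq: "Z = mob B (r (u @ [False, True]))"
    using rC[of True "u @ [False]"] w0 u by simp
  have zeq: "z = mob A (l (False # True # u))"
    using lC[of "True # u" False] w0 u by simp
  have order: "r (u @ [False, True]) \<le> l (False # True # u)"
  proof -
    define M where "M = A ** B"
    have M: "pos_mat M" unfolding M_def using pos by (simp add: pos_mat_mult)
    have m: "M $ 2 $ 2 - M $ 1 $ 1 > 0" using pm by (simp add: M_def AB algebra_simps)
    have Wp: "W (u @ [False, True]) = W u ** M" by (simp add: wprod_append M_def matrix_mul_assoc)
    have Wm: "W (False # True # u) = M ** W u" by (simp add: M_def matrix_mul_assoc)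
    have Ws: "W (True # False # u) = B ** A ** W u" by (simp add: matrix_mul_assoc)
    \<comment> \<open>The product with \<open>A ** B\<close> attains the bound on the trace, and the
      exchange keeps the determinant, hence the bound.\<close>
    have "det (B ** A ** W u) = det (M ** W u)" by (simp add: M_def det_mul)
    then have "trace (B ** A ** W u) \<le> 1 + det (M ** W u)"
      using sub[unfolded subunit_def, rule_format, of "True # False # u"] unfolding Ws by simp
    also have "\<dots> = trace (M ** W u)"
      using S_uw[OF Sm] unfolding unit_word_def Wm by simp
    finally have "(M $ 2 $ 2 - M $ 1 $ 1) * (W u $ 1 $ 1 - W u $ 2 $ 2) \<le> 0"
      by (simp add: trace_2x2 M_def AB algebra_simps)
    then have "W u $ 1 $ 1 \<le> W u $ 2 $ 2" using m by (simp add: mult_le_0_iff)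
    then show ?thesis
      using swap_order[OF M, of "W u"] m up[OF S_uw[OF Sm]] up[OF S_uw[OF Sp]]
      unfolding r_def l_def Wp Wm by simp
  qed
  have "mob A Z < mob B z"
  proof -
    \<comment> \<open>With \<open>Z\<close> and \<open>z\<close> written as images under the letters
      \<open>B\<close> and \<open>A\<close>, the claim compares \<open>A ** B\<close> with
      \<open>B ** A\<close>.\<close>
    have "mob A Z < mob B (mob A (r (u @ [False, True])))"
      unfolding Zeq by (rule mob_AB_less[OF rpos[OF Sp]])
    also have "\<dots> \<le> mob B z" unfolding zeq
      by (intro mob_mono pos mob_pos rpos[OF Sp] order)
    finally show ?thesis .
  qed
  moreover have "r w \<le> mob A Z" using hd_le[OF wS(1), of False] w by simp
  moreover have "l w \<le> mob A Z" using hd_le[OF S_rev[OF wS(1)], of False] w by (simp add: rev hd_rev unit_word_def)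
  moreover have "mob B z \<le> r w'" using hd_ge[OF wS(2), of True] w' by simp
  moreover have "mob B z \<le> l w'" using hd_ge[OF S_rev[OF wS(2)], of True] w' by (simp add: rev hd_rev unit_word_def)
  \<comment> \<open>Both fixed points of \<open>w\<close> lie at or below \<open>mob A Z\<close>,
    both fixed points of \<open>w'\<close> at or above \<open>mob B z\<close>.\<close>
  ultimately have "(r w - r w') * (l w - l w') > 0" by (intro mult_neg_neg) auto
  then show False using anti[OF wS] by simp
qed

end

subsection \<open>Uniqueness of the frequency of extremal words\<close>

text \<open>Traces and determinants of words are invariant under conjugation, so the exclusion holds
  without the normal form, which the pairs met in the descent need not have.\<close>

lemma not_both_squares_nested:
  assumes n: "nested A B" and sub: "subunit A B"
    and w: "unit_word A B w" "\<not> hd w" "\<not> last w"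
    and w': "unit_word A B w'" "hd w'" "last w'"
  shows False
proof -
  obtain T where T: "invertible T" "normal_form (conjugate T A) (conjugate T B)"
    using nested_normal_form[OF n] .
  have inv: "trace (wprod (conjugate T A) (conjugate T B) v) = trace (wprod A B v)"
    "det (wprod (conjugate T A) (conjugate T B) v) = det (wprod A B v)" for v
    by (simp_all add: wprod_conjugate T(1) trace_conjugate det_conjugate)
  show False
    by (rule not_both_squares[OF T(2), of w w']) (use sub w w' in \<open>simp_all add: subunit_def unit_word_def inv\<close>)
qed

section \<open>Descent from words in \<open>A\<close> and \<open>B\<close> to words in
  \<open>A\<close> and \<open>A ** B\<close>\<close>

abbreviation subst_AB :: "bool list \<Rightarrow> bool list" where
  "subst_AB w \<equiv> concat (map (\<lambda>x. if x then [False, True] else [False]) w)"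

lemma wprod_subst_AB: "wprod A B (subst_AB w) = wprod A (A ** B) w"
  by (induction w) (auto simp: matrix_mul_assoc)

lemma length_subst_AB: "length (subst_AB w) = length w + nB w"
  and nB_subst_AB: "nB (subst_AB w) = nB w"
  by (induction w) auto

lemma ex_subst_AB:
  assumes "v = [] \<or> \<not> hd v" "\<And>x y. v \<noteq> x @ True # True # y"
  shows "\<exists>w. v = subst_AB w"
  using assms
proof (induction v rule: induct_list012)
  case 1
  then show ?case by (intro exI[of _ "[]"]) simp
next
  case (2 x)
  then show ?case by (intro exI[of _ "[False]"]) simp
next
  case (3 x y zs)
  have x: "\<not> x" using 3(3) by simp
  show ?case
  proof (cases y)
    case True
    have "zs = [] \<or> \<not> hd zs"
      using 3(4)[of "[x]" "tl zs"] True by (cases zs) auto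
    moreover have "zs \<noteq> p @ True # True # q" for p q
      using 3(4)[of "x # y # p" q] by auto
    ultimately obtain w where "zs = subst_AB w" using 3(1) by blast
    then show ?thesis using x True by (intro exI[of _ "True # w"]) simp
  next
    case False
    have "y # zs \<noteq> p @ True # True # q" for p q
      using 3(4)[of "x # p" q] by auto
    then obtain w where "y # zs = subst_AB w" using 3(2) False by auto
    then show ?thesis using x by (intro exI[of _ "False # w"]) simp
  qed
qed

text \<open>A cyclic occurrence of BB could be rotated to a word that begins and ends with B. In its
  absence, a rotation beginning with A splits into blocks A and AB.\<close>

lemma unit_word_desubst:
  assumes w: "unit_word A B w" and no: "\<And>v. unit_word A B v \<Longrightarrow> \<not> (hd v \<and> last v)"
  obtains u where "unit_word A (A ** B) u" "length w = length u + nB u" "nB w = nB u"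
proof -
  have "False \<in> set w"
  proof (rule ccontr)
    assume "False \<notin> set w"
    moreover have "w \<noteq> []" using w by (simp add: unit_word_def)
    ultimately have "hd w \<and> last w" by (metis (full_types) hd_in_set last_in_set)
    then show False using no w by blast
  qed
  then obtain p q where pq: "w = p @ False # q" by (meson split_list)
  define v where "v = (False # q) @ p"
  have v: "unit_word A B v" using unit_word_rotate w unfolding v_def pq by blast
  have "v \<noteq> x @ True # True # y" for x y
  proof
    assume "v = x @ True # True # y"
    then have "unit_word A B ((True # y) @ (x @ [True]))"
      using unit_word_rotate[of A B "x @ [True]" "True # y"] v by simp
    from no[OF this] show False by simp
  qed
  then obtain u where u: "v = subst_AB u" using ex_subst_AB[of v] by (auto simp: v_def)
  show thesis
  proof (rule that)
    show "unit_word A (A ** B) u"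
      using v unfolding unit_word_def wprod_subst_AB[symmetric] u[symmetric] by (auto simp: u)
    have "length w = length v" "nB w = nB v" by (simp_all add: v_def pq)
    then show "length w = length u + nB u" "nB w = nB u"
      by (simp_all add: u length_subst_AB nB_subst_AB)
  qed
qed

lemma wprod_map_Not: "wprod B A (map Not w) = wprod A B w"
  by (induction w) auto

lemma nB_map_Not: "nB (map Not w) + nB w = length w"
  by (induction w) auto

lemma unit_word_map_Not: "unit_word B A (map Not w) \<longleftrightarrow> unit_word A B w"
  by (simp add: unit_word_def wprod_map_Not)

lemma subunit_commute: "subunit A B \<Longrightarrow> subunit B A"
  unfolding subunit_def using wprod_map_Not by metis

text \<open>Frequencies are compared by cross-multiplication, which the substitution respects: a
  word becomes longer by its number of B, and the extra terms \<open>nB u * nB u'\<close> cancel.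
  The pair is arbitrary in the induction because the descent changes it.\<close>

lemma unit_words_same_frequency:
  assumes "nested A B" "subunit A B" "unit_word A B w" "unit_word A B w'"
  shows "nB w * length w' = nB w' * length w"
  using assms
proof (induction "length w + length w'" arbitrary: A B w w' rule: less_induct)
  case less
  have noBB: "nB v * length v' = nB v' * length v"
    if n: "nested C D" and sub: "subunit C D" and v: "unit_word C D v" "unit_word C D v'"
      and len: "length v + length v' = length w + length w'"
      and no: "\<And>v. unit_word C D v \<Longrightarrow> \<not> (hd v \<and> last v)" for C D v v'
  proof -
    obtain u where u: "unit_word C (C ** D) u" "length v = length u + nB u" "nB v = nB u"
      using unit_word_desubst[OF v(1) no] .
    obtain u' where u': "unit_word C (C ** D) u'" "length v' = length u' + nB u'" "nB v' = nB u'"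
      using unit_word_desubst[OF v(2) no] .
    show ?thesis
    proof (cases "nB u = 0 \<and> nB u' = 0")
      case True
      then show ?thesis using u u' by simp
    next
      case False
      \<comment> \<open>Words in \<open>C\<close> and \<open>C ** D\<close> are words in
        \<open>C\<close> and \<open>D\<close>. The total length drops by
        \<open>nB u + nB u'\<close>, which is 0 only if both words are powers of
        \<open>C\<close>.\<close>
      have "subunit C (C ** D)" using sub by (simp add: subunit_def flip: wprod_subst_AB)
      moreover have "nB u + nB u' > 0" using False by simp
      then have "length u + length u' < length w + length w'"
        using len unfolding u(2) u'(2) by linarith
      ultimately have "nB u * length u' = nB u' * length u"
        by (intro less.hyps[OF _ nested_mult[OF n] _ u(1) u'(1)])
      then show ?thesis using u u' by (simp add: algebra_simps)
    qed
  qed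
  show ?case
  proof (cases "\<exists>v. unit_word A B v \<and> hd v \<and> last v")
    case False
    then show ?thesis by (intro noBB[of A B w w'] less.prems refl) blast
  next
    case True
    \<comment> \<open>A unit word with a cyclic BB excludes those with a cyclic AA, so the pair with
      exchanged letters falls under \<open>noBB\<close>.\<close>
    have "\<not> (hd v \<and> last v)" if "unit_word B A v" for v
    proof
      assume hl: "hd v \<and> last v"
      have "v \<noteq> []" using that by (simp add: unit_word_def)
      then have "\<not> hd (map Not v)" "\<not> last (map Not v)" using hl by (simp_all add: hd_map last_map)
      moreover have "unit_word A B (map Not v)" using that by (simp add: unit_word_map_Not)
      ultimately show False using not_both_squares_nested[OF less.prems(1,2)] True by blast
    qed
    then have "nB (map Not w) * length (map Not w') = nB (map Not w') * length (map Not w)"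
      using less.prems by (intro noBB[of B A])
        (auto simp: nested_commute subunit_commute unit_word_map_Not)
    then have "int (nB (map Not w)) * int (length w') = int (nB (map Not w')) * int (length w)"
      by (metis length_map of_nat_mult)
    moreover have "int (nB (map Not w)) = int (length w) - int (nB w)"
      "int (nB (map Not w')) = int (length w') - int (nB w')"
      using nB_map_Not[of w] nB_map_Not[of w'] by linarith+
    ultimately have "(int (length w) - int (nB w)) * int (length w') = (int (length w') - int (nB w')) * int (length w)"
      by (simp only:)
    then have "int (nB w) * int (length w') = int (nB w') * int (length w)"
      by (simp add: left_diff_distrib)
    then show ?thesis by (metis of_nat_eq_iff of_nat_mult)
  qed
qed

section \<open>Dependence on the scaling of the letters, and the covering argument\<close>

lemma growth_scaleR:
  assumes "pos_mat A" "pos_mat B" "a > 0" "b > 0" "w \<noteq> []"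
  shows "growth (a *\<^sub>R A) (b *\<^sub>R B) w
    = growth A B w + ln a * (1 - nB w / length w) + ln b * (nB w / length w)"
proof -
  define c where "c = a ^ (length w - nB w) * b ^ nB w"
  have c: "c > 0" using assms by (simp add: c_def)
  have X: "real_spectrum (wprod A B w)" using assms by (intro wprod_real_spectrum)
  have "nB w \<le> length w" by simp
  then have "ln c = (real (length w) - real (nB w)) * ln a + nB w * ln b"
    using assms by (simp add: c_def ln_mult ln_realpow of_nat_diff)
  then have "ln (perron (wprod (a *\<^sub>R A) (b *\<^sub>R B) w))
      = (real (length w) - real (nB w)) * ln a + nB w * ln b + ln (perron (wprod A B w))"
    unfolding wprod_scaleR c_def[symmetric]
    using perron_scaleR[OF c X] perron_pos[OF X] c by (simp add: ln_mult)
  then show ?thesis using assms by (simp add: growth_def field_simps)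
qed

lemma max_words_same_frequency:
  assumes n: "nested A B" and w: "max_word A B w" "max_word A B w'"
  shows "nB w / length w = nB w' / length w'"
proof -
  define J where "J = growth A B w"
  have pos: "pos_mat A" "pos_mat B" using n by (simp_all add: nested_def)
  have ne: "w \<noteq> []" "w' \<noteq> []" using w by (simp_all add: max_word_def)
  have le: "growth A B v \<le> J" if "v \<noteq> []" for v using w that by (simp add: J_def max_word_def)
  have eq: "growth A B w' = J"
    using w ne by (metis J_def antisym max_word_def)
  \<comment> \<open>This rescaling turns the maximal growth \<open>J\<close> into 0, so maximizing
    words become unit words of a subunit pair.\<close>
  define A' B' where "A' = exp (- J) *\<^sub>R A" and "B' = exp (- J) *\<^sub>R B"
  have n': "nested A' B'" using n by (simp add: A'_def B'_def nested_scaleR)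
  have sp: "real_spectrum (wprod A' B' v)" for v
    using n' by (intro wprod_real_spectrum) (simp_all add: nested_def)
  have g: "ln (perron (wprod A' B' v)) = (growth A B v - J) * length v" if "v \<noteq> []" for v
  proof -
    have "growth A' B' v = growth A B v - J"
      unfolding A'_def B'_def using that by (subst growth_scaleR[OF pos]) (auto simp: algebra_simps)
    then have "growth A' B' v * length v = (growth A B v - J) * length v" by simp
    then show ?thesis using that unfolding growth_def[of A' B'] by simp
  qed
  have sub: "subunit A' B'" unfolding subunit_def
  proof
    fix v
    have "perron (wprod A' B' v) \<le> 1" if "v \<noteq> []"
    proof -
      have "ln (perron (wprod A' B' v)) \<le> 0"
        using g[OF that] le[OF that] by (simp add: mult_nonpos_nonneg)
      then show ?thesis using perron_pos[OF sp] by simp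
    qed
    then show "det (wprod A' B' v) \<le> 1 \<and> trace (wprod A' B' v) \<le> 1 + det (wprod A' B' v)"
    proof (cases "v = []")
      case True
      then show ?thesis by (simp add: trace_2x2)
    next
      case False
      then show ?thesis using perron_le_1_iff(1)[OF sp[of v]] \<open>v \<noteq> [] \<Longrightarrow> perron (wprod A' B' v) \<le> 1\<close> by blast
    qed
  qed
  have unit: "unit_word A' B' v" if "v \<noteq> []" "growth A B v = J" for v
  proof -
    have "perron (wprod A' B' v) = 1" using g[OF that(1)] perron_pos[OF sp] that(2) by simp
    then show ?thesis using perron_le_1_iff(2)[OF sp[of v]] that by (simp add: unit_word_def)
  qed
  have "nB w * length w' = nB w' * length w"
    by (rule unit_words_same_frequency[OF n' sub unit[OF ne(1) J_def[symmetric]] unit[OF ne(2) eq]])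
  then have "real (nB w) * real (length w') = real (nB w') * real (length w)"
    unfolding of_nat_mult[symmetric] by (simp only:)
  then show ?thesis using ne by (simp add: field_simps)
qed

lemma nested_ex_no_max_word:
  assumes n: "nested A B"
  shows "\<exists>t>0. \<forall>w. \<not> max_word A (t *\<^sub>R B) w"
proof (rule ccontr)
  assume "\<not> ?thesis"
  then have ex: "\<exists>w. max_word A (exp \<tau> *\<^sub>R B) w" for \<tau> by (metis exp_gt_zero)
  have pos: "pos_mat A" "pos_mat B" using n by (simp_all add: nested_def)
  define f where "f w = nB w / length w" for w :: "bool list"
  define L where "L w \<tau> = growth A B w + \<tau> * f w" for w \<tau>
  have gr: "growth A (exp \<tau> *\<^sub>R B) w = L w \<tau>" if "w \<noteq> []" for w \<tau>
    using growth_scaleR[OF pos, of 1 "exp \<tau>" w] that by (simp add: L_def f_def)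
  define F where "F w = {\<tau>. max_word A (exp \<tau> *\<^sub>R B) w}" for w
  have F_eq: "F w = (if w = [] then {} else (\<Inter>v\<in>{v. v \<noteq> []}. {\<tau>. L v \<tau> \<le> L w \<tau>}))" for w
    by (auto simp: F_def max_word_def gr)
  \<comment> \<open>Each condition compares two affine functions of \<tau>.\<close>
  have closed: "closed (F w)" for w
    unfolding F_eq L_def by (auto intro!: closed_INT closed_Collect_le continuous_intros)
  have F_same: "F v = F w" if "\<tau> \<in> F v" "\<tau> \<in> F w" for v w \<tau>
  proof -
    have ne: "v \<noteq> []" "w \<noteq> []" using that by (auto simp: F_def max_word_def)
    have "f v = f w" unfolding f_def
      using max_words_same_frequency[of A "exp \<tau> *\<^sub>R B" v w] that nested_scaleR[OF n, of 1 "exp \<tau>"]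
      by (simp add: F_def)
    moreover have "L v \<tau> \<le> L w \<tau>" "L w \<tau> \<le> L v \<tau>" using that ne by (simp_all add: F_eq)
    ultimately have "growth A B v = growth A B w" by (simp add: L_def)
    then have "L v = L w" using \<open>f v = f w\<close> by (simp add: L_def fun_eq_iff)
    then show ?thesis using ne by (simp add: F_eq)
  qed
  obtain w0 where w0: "0 \<in> F w0" using ex[of 0] by (auto simp: F_def)
  define C where "C = growth A B w0"
  have C: "growth A B v \<le> C" if "v \<noteq> []" for v
    using w0 that unfolding F_eq by (auto simp: L_def C_def split: if_splits)
  define gA gB where "gA = growth A B [False]" and "gB = growth A B [True]"
  \<comment> \<open>A word maximizing at both \<open>- R\<close> and \<open>R\<close> is compared
    with the letter \<open>A\<close> at the left end and with \<open>B\<close> at the right end.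
    Adding the two inequalities gives \<open>gA + gB + R\<close> at most \<open>2 * C\<close>, which
    this choice of \<open>R\<close> violates.\<close>
  define R where "R = 2 * (C - gA) + 2 * (C - gB) + 1"
  have gC: "gA \<le> C" "gB \<le> C" unfolding gA_def gB_def by (auto intro!: C)
  then have R: "R > 0" "R > 2 * (C - gA)" "R > 2 * (C - gB)" by (simp_all add: R_def)
  have not_both: "\<not> (- R \<in> F w \<and> R \<in> F w)" for w
  proof
    assume h: "- R \<in> F w \<and> R \<in> F w"
    then have ne: "w \<noteq> []" by (auto simp: F_eq)
    have "L [False] (- R) \<le> L w (- R)" "L [True] R \<le> L w R" using h ne by (auto simp: F_eq)
    then have "gA \<le> growth A B w - R * f w" "gB + R \<le> growth A B w + R * f w"
      by (simp_all add: L_def gA_def gB_def f_def)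
    then have "gA + gB + R \<le> 2 * C" using C[OF ne] by simp
    then show False using R by simp
  qed
  \<comment> \<open>Empty traces are dropped because Sierpinski's theorem concerns non-empty closed
    sets; it leaves the whole interval as the only member.\<close>
  define \<U> where "\<U> = (\<lambda>w. F w \<inter> {- R..R}) ` UNIV - {{}}"
  have "\<U> = {{- R..R}}"
  proof (rule real_Sierpinski_lemma)
    show "- R \<le> R" using R by simp
    show "countable \<U>" unfolding \<U>_def by blast
    show "pairwise disjnt \<U>"
      unfolding pairwise_def disjnt_def \<U>_def using F_same by blast
    show "closed S \<and> S \<noteq> {}" if "S \<in> \<U>" for S
      using that closed by (auto simp: \<U>_def)
    show "\<Union> \<U> = {- R..R}"
    proof
      show "{- R..R} \<subseteq> \<Union> \<U>"
      proof
        fix \<tau> assume "\<tau> \<in> {- R..R}"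
        moreover obtain w where "\<tau> \<in> F w" using ex[of \<tau>] by (auto simp: F_def)
        ultimately show "\<tau> \<in> \<Union> \<U>" unfolding \<U>_def by blast
      qed
    qed (auto simp: \<U>_def)
  qed
  then have "{- R..R} \<in> \<U>" by simp
  then obtain w where "{- R..R} = F w \<inter> {- R..R}" unfolding \<U>_def by blast
  moreover have "- R \<in> {- R..R}" "R \<in> {- R..R}" using R by simp_all
  ultimately have "- R \<in> F w \<and> R \<in> F w" by blast
  then show False using not_both by blast
qed

subsection \<open>Pairs that are not nested\<close>

lemma perron_eigenvector:
  assumes "real_spectrum X"
  obtains v :: "real^2" where "v \<noteq> 0" "X *v v = perron X *\<^sub>R v"
proof -
  define M where "M = X - mat (perron X)"
  have "det M = perron X * perron X - trace X * perron X + det X"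
    by (simp add: M_def det_2 mat_def trace_2x2 algebra_simps)
  also have "\<dots> = 0" unfolding perron_char[OF assms] by (simp add: algebra_simps)
  finally have "\<not> invertible M" by (simp add: invertible_det_nz)
  then obtain v where v: "v \<noteq> 0" "M *v v = 0"
    by (metis invertible_left_inverse matrix_left_invertible_ker)
  have "X *v v = perron X *\<^sub>R v"
    using v(2) by (simp add: M_def vec_eq_iff forall_2 matrix_vector_mult_def sum_2 mat_def algebra_simps)
  then show thesis using that v(1) by blast
qed

lemma norm_symmetric_le:
  assumes X: "real_spectrum X" and sym: "X $ 1 $ 2 = X $ 2 $ 1"
  shows "norm (X *v v) \<le> perron X * norm v"
proof -
  define a b d where "a = X $ 1 $ 1" and "b = X $ 2 $ 1" and "d = X $ 2 $ 2"
  define l where "l = perron X"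
  define x y where "x = v $ 1" and "y = v $ 2"
  have ent: "X $ 1 $ 1 = a" "X $ 2 $ 1 = b" "X $ 1 $ 2 = b" "X $ 2 $ 2 = d"
    by (simp_all add: a_def b_def d_def sym)
  have l: "l > 0" "l \<ge> a + d - l" "a * d - b * b = l * (a + d - l)" "a + d - l > 0"
    using perron_facts[OF X] by (simp_all add: l_def trace_2x2 det_2 ent)
  have prod: "(l - a) * (l - d) = b * b" using l(3) by (simp add: algebra_simps)
  have nn: "l - a \<ge> 0 \<and> l - d \<ge> 0"
  proof -
    have "(l - a) * (l - d) \<ge> 0" unfolding prod by simp
    moreover have "(l - a) + (l - d) \<ge> 0" using l(2) by simp
    ultimately show ?thesis by (auto simp: zero_le_mult_iff)
  qed
  have psd: "(l - a) * x\<^sup>2 + (l - d) * y\<^sup>2 - 2 * b * (x * y) \<ge> 0"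
  proof (cases "l - a = 0")
    case True
    then have "b = 0" using prod by simp
    then show ?thesis using nn by simp
  next
    case False
    then have p: "l - a > 0" using nn by simp
    have "(l - a) * ((l - a) * x\<^sup>2 + (l - d) * y\<^sup>2 - 2 * b * (x * y))
        = ((l - a) * x - b * y)\<^sup>2 + ((l - a) * (l - d) - b * b) * y\<^sup>2"
      by (simp add: power2_eq_square algebra_simps)
    also have "\<dots> \<ge> 0" using prod by simp
    finally show ?thesis using p by (simp add: zero_le_mult_iff)
  qed
  \<comment> \<open>By Cayley-Hamilton, \<open>l\<^sup>2\<close> minus the square of
    \<open>X\<close> is \<open>trace X\<close> times \<open>l\<close> minus \<open>X\<close>, whose
    quadratic form is non-negative by \<open>psd\<close>.\<close>
  have "l\<^sup>2 * (x\<^sup>2 + y\<^sup>2) - ((a * x + b * y)\<^sup>2 + (b * x + d * y)\<^sup>2)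
      = (a + d) * ((l - a) * x\<^sup>2 + (l - d) * y\<^sup>2 - 2 * b * (x * y))
        + ((a * d - b * b) - l * (a + d - l)) * (x\<^sup>2 + y\<^sup>2)"
    by (simp add: power2_eq_square algebra_simps)
  also have "\<dots> \<ge> 0" using psd l by simp
  finally have "(a * x + b * y)\<^sup>2 + (b * x + d * y)\<^sup>2 \<le> l\<^sup>2 * (x\<^sup>2 + y\<^sup>2)" by simp
  then have "sqrt ((a * x + b * y)\<^sup>2 + (b * x + d * y)\<^sup>2) \<le> sqrt (l\<^sup>2 * (x\<^sup>2 + y\<^sup>2))"
    by (rule real_sqrt_le_mono)
  also have "\<dots> = l * sqrt (x\<^sup>2 + y\<^sup>2)" using l(1) by (simp add: real_sqrt_mult)
  finally show ?thesis
    by (simp add: norm_vec_def L2_set_def sum_2 matrix_vector_mult_def ent x_def y_def l_def)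
qed

abbreviation letter_bound :: "mat2 \<Rightarrow> mat2 \<Rightarrow> bool list \<Rightarrow> real" where
  "letter_bound A B w \<equiv> perron A ^ (length w - nB w) * perron B ^ nB w"

lemma letter_bound_Cons:
  "letter_bound A B (x # w) = (if x then perron B else perron A) * letter_bound A B w"
  by (simp add: Suc_diff_le)

text \<open>For a symmetric letter the spectral radius bounds the Euclidean operator norm, which is
  submultiplicative; the product itself need not be symmetric.\<close>

lemma perron_wprod_symmetric:
  assumes A: "real_spectrum A" "A $ 1 $ 2 = A $ 2 $ 1" and B: "real_spectrum B" "B $ 1 $ 2 = B $ 2 $ 1"
    and W: "real_spectrum (wprod A B w)"
  shows "perron (wprod A B w) \<le> letter_bound A B w"
proof -
  have le: "norm (wprod A B w *v v) \<le> letter_bound A B w * norm v" for v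
  proof (induction w)
    case (Cons x w)
    define X where "X = (if x then B else A)"
    have X: "real_spectrum X" "X $ 1 $ 2 = X $ 2 $ 1" using A B by (simp_all add: X_def)
    have "wprod A B (x # w) *v v = X *v (wprod A B w *v v)"
      by (simp add: X_def matrix_vector_mul_assoc)
    then have "norm (wprod A B (x # w) *v v) \<le> perron X * norm (wprod A B w *v v)"
      using norm_symmetric_le[OF X] by simp
    also have "\<dots> \<le> perron X * (letter_bound A B w * norm v)"
      using Cons perron_pos[OF X(1)] by (intro mult_left_mono) auto
    finally show ?case unfolding letter_bound_Cons by (simp add: X_def mult.assoc split: if_splits)
  qed simp
  obtain v where v: "v \<noteq> 0" "wprod A B w *v v = perron (wprod A B w) *\<^sub>R v"
    using perron_eigenvector[OF W] .
  have "perron (wprod A B w) * norm v \<le> letter_bound A B w * norm v"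
    using le[of v] perron_pos[OF W] unfolding v(2) by simp
  then show ?thesis using v(1) by simp
qed

lemma triangular_diag_le:
  assumes X: "real_spectrum X" and tri: "X $ 2 $ 1 = 0"
  shows "0 < X $ 1 $ 1" "0 < X $ 2 $ 2" "X $ 1 $ 1 \<le> perron X" "X $ 2 $ 2 \<le> perron X"
    "perron X = max (X $ 1 $ 1) (X $ 2 $ 2)"
proof -
  have "X $ 1 $ 1 * X $ 2 $ 2 > 0" "X $ 1 $ 1 + X $ 2 $ 2 > 0"
    using X tri by (simp_all add: real_spectrum_def det_2 trace_2x2)
  then show p: "0 < X $ 1 $ 1" "0 < X $ 2 $ 2" by (auto simp: zero_less_mult_iff)
  show e: "perron X = max (X $ 1 $ 1) (X $ 2 $ 2)"
    by (rule perron_eqI[of _ _ "min (X $ 1 $ 1) (X $ 2 $ 2)"])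
      (use tri in \<open>auto simp: det_2 trace_2x2 max_def min_def\<close>)
  show "X $ 1 $ 1 \<le> perron X" "X $ 2 $ 2 \<le> perron X" unfolding e by auto
qed

lemma perron_wprod_triangular:
  assumes A: "real_spectrum A" "A $ 2 $ 1 = 0" and B: "real_spectrum B" "B $ 2 $ 1 = 0"
    and W: "real_spectrum (wprod A B w)"
  shows "perron (wprod A B w) \<le> letter_bound A B w"
proof -
  have "wprod A B w $ 2 $ 1 = 0
    \<and> 0 < wprod A B w $ 1 $ 1 \<and> wprod A B w $ 1 $ 1 \<le> letter_bound A B w
    \<and> 0 < wprod A B w $ 2 $ 2 \<and> wprod A B w $ 2 $ 2 \<le> letter_bound A B w"
  proof (induction w)
    case (Cons x w)
    define X where "X = (if x then B else A)"
    have X: "real_spectrum X" "X $ 2 $ 1 = 0" using A B by (simp_all add: X_def)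
    have W: "wprod A B (x # w) = X ** wprod A B w" by (simp add: X_def)
    have lb: "letter_bound A B (x # w) = perron X * letter_bound A B w"
      unfolding letter_bound_Cons by (simp add: X_def)
    note d = triangular_diag_le[OF X]
    show ?case unfolding W lb using Cons X d(1-4) by (auto intro!: mult_mono)
  qed simp
  then show ?thesis using triangular_diag_le(5)[OF W] by simp
qed

lemma triangularize:
  fixes X :: mat2
  assumes "l * l - trace X * l + det X = 0"
  obtains T where "invertible T" "conjugate T X $ 2 $ 1 = 0"
proof (cases "X $ 2 $ 1 = 0")
  case True
  show thesis
  proof (rule that)
    have i: "invertible (mat 1 :: mat2)" by (simp add: invertible_2x2_iff)
    then have "conjugate (mat 1) X = X" by (intro conjugate_eqI) simp_all
    then show "conjugate (mat 1) X $ 2 $ 1 = 0" using True by simp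
    show "invertible (mat 1 :: mat2)" by (fact i)
  qed
next
  case False
  \<comment> \<open>The columns are an eigenvector for \<open>l\<close> and the first basis
    vector.\<close>
  define T where "T = mat2_of (l - X $ 2 $ 2) 1 (X $ 2 $ 1) 0"
  have i: "invertible T" using False by (simp add: T_def invertible_2x2_iff)
  have "X ** T = T ** mat2_of l 1 0 (trace X - l)"
    using assms by (simp add: mat2_eq_iff T_def trace_2x2 det_2 algebra_simps)
  then have "conjugate T X = mat2_of l 1 0 (trace X - l)" using i by (intro conjugate_eqI)
  then show thesis using that i by simp
qed

text \<open>By cyclicity of the trace, \<open>A\<close> and \<open>B\<close> are orthogonal to their
  commutator for the trace form. A canonical form of the commutator thus dictates a common shape: a
  scaled rotation makes both matrices symmetric, a nonzero nilpotent makes both triangular.\<close>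

lemma trace_mult_commutator:
  fixes A B :: mat2
  shows "trace (A ** (B ** A - A ** B)) = 0" "trace (B ** (B ** A - A ** B)) = 0"
  by (simp_all add: trace_2x2 algebra_simps)

lemma conjugate_commutator:
  "invertible T \<Longrightarrow> conjugate T (B ** A - A ** B)
     = conjugate T B ** conjugate T A - conjugate T A ** conjugate T B"
  by (simp add: conjugate_diff conjugate_mult)

lemma simultaneously_symmetric:
  assumes "det (B ** A - A ** B :: mat2) > 0"
  obtains T where "invertible T" "conjugate T A $ 1 $ 2 = conjugate T A $ 2 $ 1"
    "conjugate T B $ 1 $ 2 = conjugate T B $ 2 $ 1"
proof -
  define K where "K = B ** A - A ** B"
  define p q r k where "p = K $ 1 $ 1" and "q = K $ 1 $ 2" and "r = K $ 2 $ 1" and "k = sqrt (det K)"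
  have "trace K = 0" by (simp add: K_def trace_2x2 algebra_simps)
  then have K: "K = mat2_of p q r (- p)"
    by (simp add: mat2_eq_iff p_def q_def r_def trace_2x2 eq_neg_iff_add_eq_0)
  have d: "det K > 0" using assms by (simp add: K_def)
  have k: "k > 0" "k * k = - p * p - q * r" using d by (simp_all add: k_def) (simp add: K det_2)
  have "r \<noteq> 0"
  proof
    assume "r = 0"
    then have "k * k = - (p * p)" using k(2) by simp
    moreover have "p * p \<ge> 0" by simp
    moreover have "k * k > 0" by (rule mult_pos_pos[OF k(1) k(1)])
    ultimately show False by linarith
  qed
  \<comment> \<open>The columns are \<open>k\<close> times the first basis vector and its image
    under \<open>K\<close>. As the square of \<open>K\<close> is \<open>- k * k\<close> times the
    identity, \<open>K\<close> acts on them as a right-angle rotation scaled by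
    \<open>k\<close>.\<close>
  define T where "T = mat2_of k p 0 r"
  have T: "invertible T" using k \<open>r \<noteq> 0\<close> by (simp add: T_def invertible_2x2_iff)
  have "K ** T = T ** mat2_of 0 (- k) k 0"
    using k by (simp add: mat2_eq_iff T_def K algebra_simps)
  then have "conjugate T K = mat2_of 0 (- k) k 0" using T by (intro conjugate_eqI)
  then have K': "conjugate T B ** conjugate T A - conjugate T A ** conjugate T B = mat2_of 0 (- k) k 0"
    unfolding K_def conjugate_commutator[OF T] .
  have "trace (conjugate T A ** mat2_of 0 (- k) k 0) = 0" "trace (conjugate T B ** mat2_of 0 (- k) k 0) = 0"
    unfolding K'[symmetric] by (rule trace_mult_commutator)+
  then have "k * (conjugate T A $ 1 $ 2 - conjugate T A $ 2 $ 1) = 0"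
    "k * (conjugate T B $ 1 $ 2 - conjugate T B $ 2 $ 1) = 0"
    by (simp_all add: trace_2x2 algebra_simps)
  then show thesis using that[OF T] k by simp
qed

text \<open>The kernel of a nonzero nilpotent commutator is a line invariant under both matrices. If
  the commutator vanishes, an eigenline of \<open>A\<close> serves, unless \<open>B\<close> moves
  it; then \<open>A\<close> is scalar and an eigenline of \<open>B\<close> serves.\<close>

lemma simultaneously_triangular:
  assumes A: "real_spectrum A" and B: "real_spectrum B" and K0: "det (B ** A - A ** B) = 0"
  obtains T where "invertible T" "conjugate T A $ 2 $ 1 = 0" "conjugate T B $ 2 $ 1 = 0"
proof -
  define K where "K = B ** A - A ** B"
  have tr: "trace K = 0" by (simp add: K_def trace_2x2 algebra_simps)
  have eig: "perron X * perron X - trace X * perron X + det X = 0" if "real_spectrum X" for X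
    using perron_char[OF that] by (simp add: algebra_simps)
  show thesis
  proof (cases "K = 0")
    case False
    obtain T where T: "invertible T" "conjugate T K $ 2 $ 1 = 0"
      using triangularize[of 0 K] K0 by (auto simp: K_def)
    define k where "k = conjugate T K $ 1 $ 2"
    have "trace (conjugate T K) = 0" "det (conjugate T K) = 0"
      using T tr K0 by (simp_all add: trace_conjugate det_conjugate K_def)
    then have eq: "conjugate T K = mat2_of 0 k 0 0"
      using T(2) by (auto simp: mat2_eq_iff k_def trace_2x2 det_2)
    have "k \<noteq> 0"
    proof
      assume "k = 0"
      then have "conjugate T K = 0" by (simp add: eq mat2_eq_iff)
      then have "K ** T = T ** 0" using mult_conjugate[OF T(1), of K] by simp
      then have "K ** (T ** matrix_inv T) = 0" by (simp add: matrix_mul_assoc mat2_eq_iff)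
      then show False using False T(1) by (simp add: matrix_inv_right)
    qed
    have K': "conjugate T B ** conjugate T A - conjugate T A ** conjugate T B = mat2_of 0 k 0 0"
      using eq unfolding K_def conjugate_commutator[OF T(1)] .
    have "trace (conjugate T A ** mat2_of 0 k 0 0) = 0" "trace (conjugate T B ** mat2_of 0 k 0 0) = 0"
      unfolding K'[symmetric] by (rule trace_mult_commutator)+
    then show thesis using that[OF T(1)] \<open>k \<noteq> 0\<close> by (simp add: trace_2x2)
  next
    case True
    obtain T where T: "invertible T" "conjugate T A $ 2 $ 1 = 0"
      using triangularize[OF eig[OF A]] .
    define A' B' where "A' = conjugate T A" and "B' = conjugate T B"
    have "conjugate T K = 0" unfolding True by (rule conjugate_eqI[OF T(1)]) (simp add: mat2_eq_iff)
    then have K': "B' ** A' - A' ** B' = 0"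
      unfolding K_def conjugate_commutator[OF T(1)] A'_def B'_def .
    have e: "B' $ 2 $ 1 * (A' $ 1 $ 1 - A' $ 2 $ 2) = 0" "A' $ 1 $ 2 * B' $ 2 $ 1 = 0"
      using arg_cong[OF K', of "\<lambda>X. X $ 2 $ 1"] arg_cong[OF K', of "\<lambda>X. X $ 1 $ 1"] T(2)
      by (simp_all add: A'_def[symmetric] algebra_simps)
    show thesis
    proof (cases "B' $ 2 $ 1 = 0")
      case True
      then show thesis using that T by (simp add: B'_def)
    next
      case False
      then have A': "A' = A' $ 1 $ 1 *\<^sub>R mat 1"
        using e T(2) by (simp add: mat2_eq_iff A'_def)
      have "perron B * perron B - trace B' * perron B + det B' = 0"
        using eig[OF B] T(1) by (simp add: B'_def trace_conjugate det_conjugate)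
      then obtain S where S: "invertible S" "conjugate S B' $ 2 $ 1 = 0"
        by (rule triangularize)
      have "conjugate S A' = A' $ 1 $ 1 *\<^sub>R mat 1"
        by (subst A') (simp add: conjugate_scaleR conjugate_mat_1 S)
      then have "conjugate S A' $ 2 $ 1 = 0" by simp
      then show thesis using that[of "T ** S"] S T
        by (simp add: A'_def B'_def conjugate_conjugate invertible_mult)
    qed
  qed
qed

lemma perron_wprod_le:
  assumes A: "pos_mat A" and B: "pos_mat B" and K: "det (A ** B - B ** A) \<ge> 0"
  shows "perron (wprod A B w) \<le> letter_bound A B w"
proof -
  have sp: "real_spectrum A" "real_spectrum B" "real_spectrum (wprod A B w)"
    using A B by (simp_all add: pos_mat_real_spectrum wprod_real_spectrum)
  have conj: "real_spectrum (conjugate T X) \<longleftrightarrow> real_spectrum X" if "invertible T" for T X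
    using that by (simp add: real_spectrum_def trace_conjugate det_conjugate)
  have K': "det (B ** A - A ** B) \<ge> 0" using K by (simp add: det_2 algebra_simps)
  show ?thesis
  proof (cases "det (B ** A - A ** B) = 0")
    case True
    from simultaneously_triangular[OF sp(1,2) this] obtain T where T: "invertible T"
      "conjugate T A $ 2 $ 1 = 0" "conjugate T B $ 2 $ 1 = 0" .
    show ?thesis using perron_wprod_triangular[of "conjugate T A" "conjugate T B" w] T sp
      by (simp add: conj wprod_conjugate perron_conjugate)
  next
    case False
    then have "det (B ** A - A ** B) > 0" using K' by simp
    from simultaneously_symmetric[OF this] obtain T where T: "invertible T"
      "conjugate T A $ 1 $ 2 = conjugate T A $ 2 $ 1" "conjugate T B $ 1 $ 2 = conjugate T B $ 2 $ 1" .
    show ?thesis using perron_wprod_symmetric[of "conjugate T A" "conjugate T B" w] T sp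
      by (simp add: conj wprod_conjugate perron_conjugate)
  qed
qed

text \<open>The growth of a word is at most a weighted mean of the growths of the two letters, so
  the better letter is maximizing.\<close>

lemma not_nested_ex_max_word:
  assumes A: "pos_mat A" and B: "pos_mat B" and K: "det (A ** B - B ** A) \<ge> 0"
  shows "\<exists>w. max_word A B w"
proof -
  define x y where "x = ln (perron A)" and "y = ln (perron B)"
  have p: "perron A > 0" "perron B > 0" using A B by (simp_all add: perron_pos pos_mat_real_spectrum)
  have "growth A B w \<le> max x y" if "w \<noteq> []" for w
  proof -
    have "ln (perron (wprod A B w)) \<le> ln (letter_bound A B w)"
      using perron_wprod_le[OF assms] perron_pos[OF wprod_real_spectrum[OF A B]] p by simp
    also have "\<dots> = (length w - nB w) * x + nB w * y"
      using p by (simp add: ln_mult ln_realpow x_def y_def)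
    also have "\<dots> \<le> (length w - nB w) * max x y + nB w * max x y"
      by (intro add_mono mult_left_mono) auto
    also have "\<dots> = length w * max x y"
      by (simp add: of_nat_diff algebra_simps)
    finally show ?thesis using that by (simp add: growth_def field_simps)
  qed
  moreover have "growth A B [False] = x" "growth A B [True] = y" by (simp_all add: growth_def x_def y_def)
  ultimately have "max_word A B [False] \<or> max_word A B [True]"
    by (cases "x \<le> y") (auto simp: max_word_def max_def)
  then show ?thesis by blast
qed

subsection \<open>Balanced pairs\<close>

lemma H_mat_eq:
  assumes "s \<noteq> u" "l \<noteq> 0"
  shows "H_mat l s u = mat2_of ((s * l - u / l) / (s - u)) (s * u * (1 / l - l) / (s - u))
     ((l - 1 / l) / (s - u)) ((s / l - u * l) / (s - u))"
proof -
  have "matrix_inv (mat2_of s u 1 1)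
      = mat2_of (1 / (s - u)) (- u / (s - u)) (- 1 / (s - u)) (s / (s - u))"
    using assms(1) by (intro matrix_inv_eqI) (simp add: mat2_eq_iff flip: diff_divide_distrib)
  then show ?thesis using assms unfolding H_mat_def
    by (simp add: mat2_eq_iff) (simp add: divide_simps, simp add: algebra_simps)
qed

text \<open>The scalar part \<open>m\<close> drops out of commutators. The traceless part is a
  positive multiple of a matrix determined by the fixed points, so \<open>l\<close> affects the sign
  computation only through \<open>h > 0\<close>.\<close>

lemma H_mat_traceless:
  assumes "u < s" "l > 1"
  obtains m h where "h > 0"
    "H_mat l s u = mat2_of (m + h * ((s + u) / 2)) (h * (- s * u)) h (m - h * ((s + u) / 2))"
proof
  have "1 / l < 1" using assms by simp
  then have "1 / l < l" using assms by linarith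
  then show "(l - 1 / l) / (s - u) > 0" using assms by simp
  show "H_mat l s u = mat2_of ((l + 1 / l) / 2 + (l - 1 / l) / (s - u) * ((s + u) / 2))
      ((l - 1 / l) / (s - u) * (- s * u)) ((l - 1 / l) / (s - u))
      ((l + 1 / l) / 2 - (l - 1 / l) / (s - u) * ((s + u) / 2))"
    using assms by (subst H_mat_eq) (auto simp: mat2_eq_iff divide_simps, auto simp: algebra_simps)
qed

lemma form_det_commutator:
  assumes "form_h {X, Y} \<or> form_m {X, Y} \<or> form_p {X, Y}"
  shows "det (X ** Y - Y ** X) < 0"
proof -
  \<comment> \<open>The forms are conditions on sets, so either matrix may come first.\<close>
  have sym: "det (X ** Y - Y ** X) < 0"
    if "X = V \<and> Y = V' \<or> X = V' \<and> Y = V" "det (V ** V' - V' ** V) < 0" for V V'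
  proof -
    have "det (V' ** V - V ** V') = det (V ** V' - V' ** V)" by (simp add: det_2 algebra_simps)
    with that show ?thesis by auto
  qed
  have "det (X ** Y - Y ** X) < 0" if h: "form_h {X, Y}"
  proof -
    have neg: "det (H_mat l1 s1 u1 ** H_mat l2 s2 u2 - H_mat l2 s2 u2 ** H_mat l1 s1 u1) < 0"
      if l: "l1 > 1" "l2 > 1" "u2 < u1" "u1 < 0" "0 < s1" "s1 < s2" for l1 l2 s1 s2 u1 u2
    proof -
      obtain m1 h1 where 1: "h1 > 0"
        "H_mat l1 s1 u1 = mat2_of (m1 + h1 * ((s1 + u1) / 2)) (h1 * (- s1 * u1)) h1 (m1 - h1 * ((s1 + u1) / 2))"
        by (rule H_mat_traceless[of u1 s1 l1]) (use l in auto)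
      obtain m2 h2 where 2: "h2 > 0"
        "H_mat l2 s2 u2 = mat2_of (m2 + h2 * ((s2 + u2) / 2)) (h2 * (- s2 * u2)) h2 (m2 - h2 * ((s2 + u2) / 2))"
        by (rule H_mat_traceless[of u2 s2 l2]) (use l in auto)
      \<comment> \<open>Up to a positive square this is minus a product of differences of the four
        fixed points, all positive since \<open>u2 < u1 < s1 < s2\<close>.\<close>
      have neg: "det (H_mat l1 s1 u1 ** H_mat l2 s2 u2 - H_mat l2 s2 u2 ** H_mat l1 s1 u1)
          = - ((h1 * h2)\<^sup>2 * ((s2 - s1) * (u1 - u2)) * ((s1 - u2) * (s2 - u1)))"
        unfolding 1(2) 2(2) by (simp add: det_2 power2_eq_square field_simps)
      also have "\<dots> < 0" using l 1(1) 2(1) by simp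
      finally show ?thesis .
    qed
    then show ?thesis using h unfolding form_h_def doubleton_eq_iff
      by (elim exE conjE) (rule sym, assumption, rule neg; assumption)
  qed
  moreover have "det (X ** Y - Y ** X) < 0" if f: "form_m {X, Y}"
  proof -
    have neg: "det (H_mat l s u ** P_mat x - P_mat x ** H_mat l s u) < 0"
      if l: "l > 1" "u < 0" "0 < s" "x > 0" for l s u x
    proof -
      obtain m h where 1: "h > 0"
        "H_mat l s u = mat2_of (m + h * ((s + u) / 2)) (h * (- s * u)) h (m - h * ((s + u) / 2))"
        by (rule H_mat_traceless[of u s l]) (use l in auto)
      have "det (H_mat l s u ** P_mat x - P_mat x ** H_mat l s u) = - (h * x * s * u)\<^sup>2"
        unfolding 1(2) by (simp add: P_mat_def det_2 power2_eq_square field_simps)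
      then show ?thesis using l 1 by simp
    qed
    then show ?thesis using f unfolding form_m_def doubleton_eq_iff
      by (elim exE conjE) (rule sym, assumption, rule neg; assumption)
  qed
  moreover have "det (X ** Y - Y ** X) < 0" if f: "form_p {X, Y}"
  proof -
    have neg: "det (P_mat x ** transpose (P_mat y) - transpose (P_mat y) ** P_mat x) < 0"
      if "x > 0" "y > 0" for x y
      using that by (simp add: P_mat_def det_2 transpose_def)
    then show ?thesis using f unfolding form_p_def doubleton_eq_iff
      by (elim exE conjE) (rule sym, assumption, rule neg; assumption)
  qed
  ultimately show ?thesis using assms by blast
qed

lemma balanced_pair_det_commutator:
  assumes "balanced_pair A B"
  shows "det (A ** B - B ** A) < 0"
proof -
  obtain a b T where T: "invertible T" and f: "form_h {conjugate T (a *\<^sub>R A), conjugate T (b *\<^sub>R B)}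
      \<or> form_m {conjugate T (a *\<^sub>R A), conjugate T (b *\<^sub>R B)}
      \<or> form_p {conjugate T (a *\<^sub>R A), conjugate T (b *\<^sub>R B)}"
    using assms unfolding balanced_pair_def balanced_pair_SL_def Let_def by blast
  have "conjugate T (a *\<^sub>R A) ** conjugate T (b *\<^sub>R B) - conjugate T (b *\<^sub>R B) ** conjugate T (a *\<^sub>R A)
      = conjugate T ((a * b) *\<^sub>R (A ** B - B ** A))"
  proof -
    have "(a * b) *\<^sub>R (A ** B - B ** A) = a *\<^sub>R A ** b *\<^sub>R B - b *\<^sub>R B ** a *\<^sub>R A"
      by (simp add: mat2_eq_iff algebra_simps)
    then show ?thesis by (simp add: conjugate_diff conjugate_mult T)
  qed
  then have "det (conjugate T ((a * b) *\<^sub>R (A ** B - B ** A))) < 0"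
    using form_det_commutator[OF f] by simp
  \<comment> \<open>The scalars may be negative; they enter through a square.\<close>
  then have "(a * b)\<^sup>2 * det (A ** B - B ** A) < 0"
    by (simp only: det_conjugate[OF T] det_scaleR_2x2)
  then show ?thesis by (simp add: mult_less_0_iff)
qed

text \<open>Equal diagonal entries make the fixed points opposite, namely \<open>s\<close> and
  \<open>- s\<close> with \<open>s = sqrt (b / c)\<close>; the eigenvalues are \<open>a\<close> plus
  and minus \<open>sqrt (b * c)\<close>. The relation \<open>s\<^sup>2 * c = b\<close> is recorded
  for comparing two axes.\<close>

lemma H_mat_symmetric:
  assumes "a > 0" "b > 0" "c > 0" "a * a - b * c = 1"
  obtains l s where "l > 1" "s > 0" "s\<^sup>2 * c = b" "mat2_of a b c a = H_mat l s (- s)"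
proof -
  define e where "e = sqrt (b * c)"
  define s where "s = sqrt (b / c)"
  have e: "e > 0" "e * e = b * c" using assms by (simp_all add: e_def)
  have s: "s > 0" "s * s = b / c" using assms by (simp_all add: s_def)
  have "s * c = sqrt (b / c) * sqrt (c * c)" using assms by (simp add: s_def)
  also have "\<dots> = e" using assms unfolding e_def real_sqrt_mult[symmetric] by simp
  finally have sc: "s * c = e" .
  have se: "s * e = b" using s(2) sc assms(3) by (metis mult.assoc nonzero_divide_eq_eq less_irrefl)
  define l where "l = a + e"
  have inv: "(a + e) * (a - e) = 1" using assms(4) e(2) by (simp add: algebra_simps)
  have "b * c > 0" using assms by simp
  then have "a * a > 1" using assms(4) by linarith
  then have "a > 1" using mult_le_one[of a a] assms(1) by linarith
  then have l: "l > 1" using e(1) by (simp add: l_def)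
  have il: "1 / l = a - e" using inv l by (simp add: l_def field_simps)
  have "mat2_of a b c a = H_mat l s (- s)"
  proof -
    have "H_mat l s (- s) = mat2_of ((l + 1 / l) / 2) (s * (l - 1 / l) / 2) ((l - 1 / l) / (2 * s)) ((l + 1 / l) / 2)"
      using s(1) l by (subst H_mat_eq) (simp_all add: mat2_eq_iff divide_simps, simp_all add: algebra_simps)
    also have "\<dots> = mat2_of a b c a"
      unfolding il using se sc s(1) by (simp add: l_def mat2_eq_iff) (simp add: field_simps)
    finally show ?thesis ..
  qed
  moreover have "s\<^sup>2 * c = b" using s assms by (simp add: power2_eq_square)
  ultimately show thesis using that l s by blast
qed

text \<open>A vanishing \<open>b\<close> makes \<open>X\<close> parabolic with diagonal entries 1, a
  vanishing \<open>c'\<close> does the same for \<open>Y\<close>. Neither gives form (h), exactly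
  one gives (m), both give (p).\<close>

lemma normal_form_balanced:
  assumes nf: "normal_form X Y" and d: "det X = 1" "det Y = 1"
  shows "\<exists>S. invertible S \<and> (form_h {conjugate S X, conjugate S Y}
    \<or> form_m {conjugate S X, conjugate S Y} \<or> form_p {conjugate S X, conjugate S Y})"
proof -
  define a b c a' b' c' where "a = X $ 1 $ 1" and "b = X $ 1 $ 2" and "c = X $ 2 $ 1"
    and "a' = Y $ 1 $ 1" and "b' = Y $ 1 $ 2" and "c' = Y $ 2 $ 1"
  have X: "X = mat2_of a b c a" and Y: "Y = mat2_of a' b' c' a'"
    using nf by (simp_all add: mat2_eq_iff normal_form_def a_def b_def c_def a'_def b'_def c'_def)
  have p: "a > 0" "a' > 0" "b \<ge> 0" "c > 0" "b' > 0" "c' \<ge> 0" "b * c' < b' * c"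
    "a * a - b * c = 1" "a' * a' - b' * c' = 1"
    using nf d by (simp_all add: X Y normal_form_def pos_mat_iff det_2)
  have one: "x = 1" if "x > 0" "x * x = 1" for x :: real
    using that by (auto simp: square_eq_1_iff)
  define id1 where "id1 = (mat 1 :: mat2)"
  define sw where "sw = mat2_of 0 1 1 0"
  have i1: "invertible id1" "conjugate id1 X = X" "conjugate id1 Y = Y"
  proof -
    show i: "invertible id1" by (simp add: id1_def invertible_2x2_iff)
    show "conjugate id1 X = X" "conjugate id1 Y = Y" using i by (auto intro!: conjugate_eqI simp: id1_def)
  qed
  consider "b > 0" "c' > 0" | "b = 0" "c' > 0" | "b > 0" "c' = 0" | "b = 0" "c' = 0"
    using p by linarith
  then show ?thesis
  proof cases
    case 1
    obtain l s where 2: "l > 1" "s > 0" "s\<^sup>2 * c = b" "X = H_mat l s (- s)"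
      using H_mat_symmetric[of a b c] 1 p unfolding X by metis
    obtain l' s' where 3: "l' > 1" "s' > 0" "s'\<^sup>2 * c' = b'" "Y = H_mat l' s' (- s')"
      using H_mat_symmetric[of a' b' c'] 1 p unfolding Y by metis
    \<comment> \<open>The determinant inequality of the normal form becomes the nesting of the two
      axes.\<close>
    have "s\<^sup>2 * (c * c') < s'\<^sup>2 * (c * c')"
      using p(7) unfolding 2(3)[symmetric] 3(3)[symmetric] by (simp add: mult_ac)
    then have "s\<^sup>2 < s'\<^sup>2" using 1 p by simp
    then have "s < s'" using 3(2) by (simp add: power2_less_imp_less)
    then have "form_h {X, Y}" unfolding form_h_def using 2 3
      by (intro exI[of _ l] exI[of _ l'] exI[of _ s] exI[of _ s'] exI[of _ "- s"] exI[of _ "- s'"]) auto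
    then show ?thesis using i1 by metis
  next
    case 2
    obtain l' s' where 3: "l' > 1" "s' > 0" "s'\<^sup>2 * c' = b'" "Y = H_mat l' s' (- s')"
      using H_mat_symmetric[of a' b' c'] 2 p unfolding Y by metis
    have "X = P_mat c" using one[of a] p 2 by (simp add: X P_mat_def)
    then have "form_m {X, Y}" unfolding form_m_def using 3 p
      by (intro exI[of _ l'] exI[of _ s'] exI[of _ "- s'"] exI[of _ c]) auto
    then show ?thesis using i1 by metis
  next
    case 3
    \<comment> \<open>The parabolic letter \<open>Y\<close> is upper triangular here; swapping the
      coordinates turns it into \<open>P_mat b'\<close>.\<close>
    have sw: "invertible sw" by (simp add: sw_def invertible_2x2_iff)
    have cX: "conjugate sw X = mat2_of a c b a" and cY: "conjugate sw Y = mat2_of a' c' b' a'"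
      by (rule conjugate_eqI[OF sw], simp add: sw_def X Y mat2_eq_iff)+
    obtain l s where 4: "l > 1" "s > 0" "s\<^sup>2 * b = c" "conjugate sw X = H_mat l s (- s)"
      using H_mat_symmetric[of a c b] 3 p unfolding cX by (metis mult.commute)
    have "conjugate sw Y = P_mat b'" using one[of a'] p 3 by (simp add: cY P_mat_def)
    then have "form_m {conjugate sw X, conjugate sw Y}" unfolding form_m_def using 4 p
      by (intro exI[of _ l] exI[of _ s] exI[of _ "- s"] exI[of _ b']) auto
    then show ?thesis using sw by metis
  next
    case 4
    have "X = P_mat c" using one[of a] p 4 by (simp add: X P_mat_def)
    moreover have "Y = transpose (P_mat b')" using one[of a'] p 4
      by (simp add: Y P_mat_def mat2_eq_iff transpose_def)
    ultimately have "form_p {X, Y}" unfolding form_p_def using p by blast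
    then show ?thesis using i1 by metis
  qed
qed

lemma normal_form_SL_A:
  assumes nf: "normal_form X Y" and d: "det X = 1" "det Y = 1" and T: "invertible T"
    and A: "X = conjugate T A" and B: "Y = conjugate T B"
  shows "A \<in> SL_A" "B \<in> SL_A"
proof -
  have tr: "trace Z \<ge> 2" if "pos_mat Z" "det Z = 1" for Z
    using pos_mat_disc[OF that(1)] pos_mat_trace_pos[OF that(1)] that(2)
      power2_le_imp_le[of 2 "trace Z"] by simp
  have "pos_mat X" "pos_mat Y" using nf by (simp_all add: normal_form_def)
  then have "trace A \<ge> 2" "trace B \<ge> 2" "det A = 1" "det B = 1"
    using tr[of X] tr[of Y] d T by (simp_all add: A B trace_conjugate det_conjugate)
  moreover have "A \<noteq> mat 1" "B \<noteq> mat 1"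
    using nf T by (auto simp: normal_form_def A B conjugate_mat_1)
  ultimately show "A \<in> SL_A" "B \<in> SL_A" by (simp_all add: SL_A_def)
qed

lemma nested_balanced_pair:
  assumes A: "A \<in> GL_pos" and B: "B \<in> GL_pos" and T: "invertible T"
    and n: "nested (conjugate T A) (conjugate T B)"
  shows "balanced_pair A B"
proof -
  define a b where "a = 1 / sqrt (det A)" and "b = 1 / sqrt (det B)"
  have det: "det A > 0" "det B > 0" using A B by (simp_all add: GL_pos_def)
  have ab: "a > 0" "b > 0" "a\<^sup>2 * det A = 1" "b\<^sup>2 * det B = 1"
    using det by (simp_all add: a_def b_def power_divide)
  have "nested (conjugate T (a *\<^sub>R A)) (conjugate T (b *\<^sub>R B))"
    using nested_scaleR[OF n ab(1,2)] by (simp add: conjugate_scaleR)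
  then obtain U where U: "invertible U"
    "normal_form (conjugate U (conjugate T (a *\<^sub>R A))) (conjugate U (conjugate T (b *\<^sub>R B)))"
    using nested_normal_form by blast
  define V where "V = T ** U"
  have V: "invertible V" using T U by (simp add: V_def invertible_mult)
  have nf: "normal_form (conjugate V (a *\<^sub>R A)) (conjugate V (b *\<^sub>R B))"
    using U by (simp add: V_def conjugate_conjugate T)
  have d: "det (conjugate V (a *\<^sub>R A)) = 1" "det (conjugate V (b *\<^sub>R B)) = 1"
    using V ab by (simp_all add: det_conjugate det_scaleR_2x2)
  obtain S where S: "invertible S"
    "form_h {conjugate S (conjugate V (a *\<^sub>R A)), conjugate S (conjugate V (b *\<^sub>R B))}
     \<or> form_m {conjugate S (conjugate V (a *\<^sub>R A)), conjugate S (conjugate V (b *\<^sub>R B))}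
     \<or> form_p {conjugate S (conjugate V (a *\<^sub>R A)), conjugate S (conjugate V (b *\<^sub>R B))}"
    using normal_form_balanced[OF nf d] by blast
  have "balanced_pair_SL (a *\<^sub>R A) (b *\<^sub>R B)"
    unfolding balanced_pair_SL_def Let_def
  proof (intro conjI exI[of _ "V ** S"])
    show "{a *\<^sub>R A, b *\<^sub>R B} \<subseteq> SL_A" using normal_form_SL_A[OF nf d V refl refl] by simp
    show "invertible (V ** S)" using V S by (simp add: invertible_mult)
  qed (use S V in \<open>simp add: conjugate_conjugate\<close>)
  then show ?thesis using A B by (auto simp: balanced_pair_def)
qed

theorem proposition5p3:
  fixes A B :: "real ^ 2 ^ 2"
  assumes "A \<in> GL_pos" and "B \<in> GL_pos"
    and "\<exists>T :: real ^ 2 ^ 2. invertible T \<and>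
           nonneg_mat (conjugate T A) \<and> nonneg_mat (conjugate T B)"
  shows "balanced_pair A B \<longleftrightarrow> (\<exists>t>0. finiteness_counterexample A (t *\<^sub>R B))"
proof -
  obtain T where T: "invertible T" "nonneg_mat (conjugate T A)" "nonneg_mat (conjugate T B)"
    using assms(3) by blast
  define A' B' where "A' = conjugate T A" and "B' = conjugate T B"
  have pos: "pos_mat A'" "pos_mat B'"
    using T assms(1,2) by (simp_all add: A'_def B'_def pos_mat_def det_conjugate GL_pos_def)
  have GL: "{A, t *\<^sub>R B} \<subseteq> GL_pos" if "t > 0" for t
    using assms(1,2) that by (auto simp: GL_pos_def invertible_det_nz det_scaleR_2x2)
  have ce: "finiteness_counterexample A (t *\<^sub>R B) \<longleftrightarrow> (\<forall>w. \<not> max_word A' (t *\<^sub>R B') w)"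
    if "t > 0" for t
    using spectrum_maximizing_iff[OF T(1), of A "t *\<^sub>R B"] GL[OF that] pos that
    by (auto simp: finiteness_counterexample_def conjugate_scaleR pos_mat_scaleR simp flip: A'_def B'_def)
  have det: "det (A' ** B' - B' ** A') = det (A ** B - B ** A)"
    using T(1) by (simp add: A'_def B'_def det_conjugate flip: conjugate_mult conjugate_diff)
  show ?thesis
  proof
    assume "balanced_pair A B"
    then have "nested A' B'"
      using pos det balanced_pair_det_commutator by (simp add: nested_def)
    then show "\<exists>t>0. finiteness_counterexample A (t *\<^sub>R B)"
      using nested_ex_no_max_word ce by blast
  next
    assume "\<exists>t>0. finiteness_counterexample A (t *\<^sub>R B)"
    then obtain t where t: "t > 0" "\<forall>w. \<not> max_word A' (t *\<^sub>R B') w" using ce by blast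
    have "det (A' ** (t *\<^sub>R B') - (t *\<^sub>R B') ** A') < 0"
      using not_nested_ex_max_word[of A' "t *\<^sub>R B'"] pos t
      by (meson not_le pos_mat_scaleR)
    then have "nested A' (t *\<^sub>R B')" using pos t by (simp add: nested_def pos_mat_scaleR)
    \<comment> \<open>Positive rescaling preserves nestedness, so the factor \<open>t\<close> can be
      undone.\<close>
    then have "nested (1 *\<^sub>R A') ((1 / t) *\<^sub>R (t *\<^sub>R B'))" using t by (intro nested_scaleR) auto
    then show "balanced_pair A B"
      using nested_balanced_pair[OF assms(1,2) T(1)] t by (simp add: A'_def B'_def)
  qed
qed

end
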